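(* For every integer $n\ge 3$, the squid graph $Sq(2n-1;1^n)$ is not strongly nice. Moreover, its chromatic symmetric function $X_{Sq(2n-1;1^n)}$ is not Schur positive.
   Context: The squid graph $Sq(2n-1;1^n)$ is obtained from the cycle $C_{2n-1}$ on vertices $u,u_1,\ldots,u_{2n-2}$ (in cyclic order) by attaching $n$ leaves $v_1,\ldots,v_n$ to the vertex $u$. For a finite simple graph $G$ with vertex set $\{w_1,\ldots,w_d\}$, its chromatic symmetric function is $X_G=\sum_\kappa x_{\kappa(w_1)}\cdots x_{\kappa(w_d)}$, summing over all proper colorings $\kappa:V(G)\to\{1,2,\ldots\}$. For a partition $\lambda$, $m_\lambda$ and $s_\lambda$ denote the monomial symmetric function and the Schur function, and $[b_\lambda]f$ the coefficient of $b_\lambda$ in $f$. For partitions of the same integer, $\mu\le\lambda$ in dominance order means $\sum_{i=1}^k\mu_i\le\sum_{i=1}^k\lambda_i$ for all $k$. A graph $G$ is strongly nice if $[m_\mu]X_G\ge[m_\lambda]X_G$ whenever $\mu\le\lambda$ in dominance order. A symmetric function $f$ is Schur positive if $[s_\lambda]f\ge0$ for all $\lambda$. *)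

theory Defs
  imports Main "HOL-Library.Multiset" "HOL-Library.FuncSet"
begin

text \<open>
  A formal power series in the variables indexed by \<^typ>\<open>nat\<close> is given by its coefficients. A
  monomial is the multiset of (the indices of) its variables. Colours and tableau entries are
  numbered from 0, so the index \<open>c\<close> stands for the variable usually written with index \<open>c + 1\<close>.
\<close>

type_synonym power_series = "nat multiset \<Rightarrow> int"

text \<open>Partitions are weakly decreasing lists of positive parts.\<close>

definition is_partition :: "nat list \<Rightarrow> bool" where
  "is_partition \<nu> \<longleftrightarrow> sorted_wrt (\<ge>) \<nu> \<and> 0 \<notin> set \<nu>"

definition dominance_le :: "nat list \<Rightarrow> nat list \<Rightarrow> bool" where
  "dominance_le \<mu> \<nu> \<longleftrightarrow>
     sum_list \<mu> = sum_list \<nu> \<and> (\<forall>k. sum_list (take k \<mu>) \<le> sum_list (take k \<nu>))"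

text \<open>The coefficient of a monomial in \<open>m\<^sub>\<nu>\<close> is 1 if its nonzero exponents, in some order, are \<open>\<nu>\<close>.\<close>

definition monomial_sym :: "nat list \<Rightarrow> power_series" where
  "monomial_sym \<nu> M = (if image_mset (count M) (mset_set (set_mset M)) = mset \<nu> then 1 else 0)"

definition cells :: "nat list \<Rightarrow> (nat \<times> nat) set" where
  "cells \<nu> = {(i, j). i < length \<nu> \<and> j < \<nu> ! i}"

definition semistandard_tableaux :: "nat list \<Rightarrow> (nat \<times> nat \<Rightarrow> nat) set" where
  "semistandard_tableaux \<nu> = {T \<in> cells \<nu> \<rightarrow>\<^sub>E UNIV.
     (\<forall>i j j'. (i, j) \<in> cells \<nu> \<longrightarrow> (i, j') \<in> cells \<nu> \<longrightarrow> j < j' \<longrightarrow> T (i, j) \<le> T (i, j')) \<and>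
     (\<forall>i i' j. (i, j) \<in> cells \<nu> \<longrightarrow> (i', j) \<in> cells \<nu> \<longrightarrow> i < i' \<longrightarrow> T (i, j) < T (i', j))}"

definition schur :: "nat list \<Rightarrow> power_series" where
  "schur \<nu> M =
     int (card {T \<in> semistandard_tableaux \<nu>. image_mset T (mset_set (cells \<nu>)) = M})"

definition is_expansion ::
  "(nat list \<Rightarrow> power_series) \<Rightarrow> power_series \<Rightarrow> (nat list \<Rightarrow> int) \<Rightarrow> bool" where
  "is_expansion b f c \<longleftrightarrow>
     finite {\<nu>. c \<nu> \<noteq> 0} \<and> (\<forall>\<nu>. c \<nu> \<noteq> 0 \<longrightarrow> is_partition \<nu>) \<and>
     (\<forall>M. f M = (\<Sum>\<nu> | c \<nu> \<noteq> 0. c \<nu> * b \<nu> M))"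

text \<open>
  The coefficient of \<open>b\<^sub>\<nu>\<close> in \<open>f\<close>. It is meaningful for a basis \<open>b\<close> (over the integers) of the ring
  of symmetric functions, indexed by partitions, and a symmetric function \<open>f\<close>: then there is
  exactly one expansion.
\<close>

definition basis_coeff :: "(nat list \<Rightarrow> power_series) \<Rightarrow> nat list \<Rightarrow> power_series \<Rightarrow> int" where
  "basis_coeff b \<nu> f = (THE c. is_expansion b f c) \<nu>"

definition schur_positive :: "power_series \<Rightarrow> bool" where
  "schur_positive f \<longleftrightarrow> (\<forall>\<nu>. is_partition \<nu> \<longrightarrow> basis_coeff schur \<nu> f \<ge> 0)"

text \<open>A finite simple graph is given by its vertex set and its set of two-element edges.\<close>

definition simple_graph :: "'a set \<Rightarrow> 'a set set \<Rightarrow> bool" where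
  "simple_graph V E \<longleftrightarrow> finite V \<and> (\<forall>e\<in>E. e \<subseteq> V \<and> card e = 2)"

definition proper_colorings :: "'a set \<Rightarrow> 'a set set \<Rightarrow> ('a \<Rightarrow> nat) set" where
  "proper_colorings V E = {\<kappa> \<in> V \<rightarrow>\<^sub>E UNIV. \<forall>v w. {v, w} \<in> E \<longrightarrow> \<kappa> v \<noteq> \<kappa> w}"

definition chromatic_sym :: "'a set \<Rightarrow> 'a set set \<Rightarrow> power_series" where
  "chromatic_sym V E M =
     int (card {\<kappa> \<in> proper_colorings V E. image_mset \<kappa> (mset_set V) = M})"

definition strongly_nice :: "'a set \<Rightarrow> 'a set set \<Rightarrow> bool" where
  "strongly_nice V E \<longleftrightarrow>
     (\<forall>\<mu> \<nu>. is_partition \<mu> \<longrightarrow> is_partition \<nu> \<longrightarrow> dominance_le \<mu> \<nu> \<longrightarrow>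
        basis_coeff monomial_sym \<mu> (chromatic_sym V E)
          \<ge> basis_coeff monomial_sym \<nu> (chromatic_sym V E))"

text \<open>
  The squid graph \<open>Sq(2n-1; 1\<^sup>n)\<close>: \<open>Cyc 0\<close> is \<open>u\<close>, \<open>Cyc i\<close> is \<open>u\<^sub>i\<close> for \<open>1 \<le> i \<le> 2n - 2\<close>, and
  \<open>Leaf j\<close> is \<open>v\<^sub>j\<close>.
\<close>

datatype squid_vertex = Cyc nat | Leaf nat

definition squid_verts :: "nat \<Rightarrow> squid_vertex set" where
  "squid_verts n = Cyc ` {0..<2 * n - 1} \<union> Leaf ` {1..n}"

definition squid_edges :: "nat \<Rightarrow> squid_vertex set set" where
  "squid_edges n =
     {{Cyc i, Cyc ((i + 1) mod (2 * n - 1))} | i. i < 2 * n - 1} \<union>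
     {{Cyc 0, Leaf j} | j. j \<in> {1..n}}"

lemma simple_graph_squid:
  assumes "n \<ge> 2"
  shows "simple_graph (squid_verts n) (squid_edges n)"
proof -
  have *: "i \<noteq> (i + 1) mod (2 * n - 1)" if "i < 2 * n - 1" for i
    using assms that by (cases "i + 1 = 2 * n - 1") auto
  have "e \<subseteq> squid_verts n \<and> card e = 2" if "e \<in> squid_edges n" for e
    using that assms * unfolding squid_edges_def squid_verts_def by auto
  then show ?thesis
    by (auto simp: simple_graph_def squid_verts_def)
qed

end

theory Submission
  imports Defs "HOL-Combinatorics.Transposition"
begin

text \<open>
  Compare the monomials with exponents \<open>\<mu> = (n, n, n - 1)\<close> and \<open>\<nu> = (n + 1, n - 1, n - 1)\<close>, where
  \<open>\<mu>\<close> lies below \<open>\<nu>\<close> in dominance order. An independent set \<open>S\<close> containing \<open>u\<close> contains no leaf and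
  meets \<open>2 * card S\<close> of the \<open>2 * n - 1\<close> cycle edges, so \<open>card S \<le> n - 1\<close>, and if equality holds then
  exactly one edge avoids \<open>S\<close>. Hence \<open>u\<close> always has a colour used \<open>n - 1\<close> times, and for each
  of the \<open>N\<close> possible classes of \<open>u\<close> the remaining \<open>2 * n\<close> vertices span a single edge. This gives
  \<open>2 * N * ((2 * n - 2) choose (n - 1))\<close> colorings of type \<open>\<mu>\<close> and, as there are two colours available
  for \<open>u\<close>, \<open>4 * N * ((2 * n - 2) choose n)\<close> of type \<open>\<nu>\<close>, which is more when \<open>n \<ge> 3\<close>.

  A Schur positive function cannot behave this way: replacing the last 0 in the first row by 1
  shows that each Schur function has a coefficient at \<open>\<mu>\<close> at least as large as that at \<open>\<nu>\<close>. That the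
  coefficients in both bases are well defined rests on the symmetry of the functions involved
  (for Schur functions, the Bender--Knuth involution) and on unitriangularity.
\<close>

section \<open>Unitriangular families of symmetric functions\<close>

text \<open>Encoding a monomial by its exponent vector turns permutations of the variables into
  rearrangements of a list. Vectors differing by trailing zeros give the same monomial.\<close>

definition monomial :: "nat list \<Rightarrow> nat multiset" where
  "monomial xs = (\<Sum>i<length xs. replicate_mset (xs ! i) i)"

lemma count_monomial: "count (monomial xs) c = (if c < length xs then xs ! c else 0)"
  by (simp add: monomial_def count_sum)

lemma size_monomial: "size (monomial xs) = sum_list xs"
  by (simp add: monomial_def sum_list_sum_nth atLeast0LessThan)

lemma monomial_append_zeros: "monomial (xs @ replicate m 0) = monomial xs"
  by (rule multiset_eqI) (auto simp: count_monomial nth_append)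

lemma ex_monomial: "\<exists>xs. M = monomial xs"
proof -
  \<comment> \<open>Any bound beyond every variable of \<open>M\<close> works; the inserted 0 covers
    the empty multiset.\<close>
  define K where "K = Suc (Max (insert 0 (set_mset M)))"
  have "c < K" if "c \<in># M" for c
    using that by (simp add: K_def less_Suc_eq_le)
  then have "M = monomial (map (count M) [0..<K])"
    by (intro multiset_eqI) (auto simp: count_monomial count_eq_zero_iff)
  then show ?thesis by blast
qed

lemma count_image_mset_transpose:
  "count (image_mset (Transposition.transpose a b) M) c = count M (Transposition.transpose a b c)"
proof -
  have "Transposition.transpose a b -` {c} = {Transposition.transpose a b c}"
    by (auto simp: Transposition.transpose_def split: if_splits)
  then show ?thesis
    by (cases "Transposition.transpose a b c \<in># M")
      (auto simp: count_image_mset count_eq_zero_iff)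
qed

lemma monomial_swap:
  "image_mset (Transposition.transpose (length xs) (Suc (length xs))) (monomial (xs @ a # b # ys))
    = monomial (xs @ b # a # ys)"
  by (rule multiset_eqI)
    (auto simp: count_image_mset_transpose count_monomial Transposition.transpose_def nth_append
      nth_Cons' split: if_splits)

text \<open>Only adjacent transpositions are asked for, because these are what the Bender--Knuth
  involution provides; they generate all rearrangements of exponents.\<close>

definition symmetric_series :: "power_series \<Rightarrow> bool" where
  "symmetric_series f \<longleftrightarrow> (\<forall>c M. f (image_mset (Transposition.transpose c (Suc c)) M) = f M)"

definition homogeneous :: "nat \<Rightarrow> power_series \<Rightarrow> bool" where
  "homogeneous d f \<longleftrightarrow> (\<forall>M. f M \<noteq> 0 \<longrightarrow> size M = d)"

lemma mset_invariant_if_swap_invariant: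
  assumes swap: "\<And>xs a b ys. h (xs @ a # b # ys) = h (xs @ b # a # ys)"
    and "mset xs = mset ys"
  shows "h xs = h ys"
proof -
  have move: "h (p @ a # xs @ ys) = h (p @ xs @ a # ys)" for p a xs ys
  proof (induction xs arbitrary: p)
    case (Cons x xs)
    show ?case using swap[of p a x "xs @ ys"] Cons[of "p @ [x]"] by simp
  qed simp
  \<comment> \<open>The prefix \<open>p\<close> collects the entries already matched: the head of
    \<open>xs\<close> is located in \<open>ys\<close>, moved to the front and absorbed into
    \<open>p\<close>.\<close>
  have "h (p @ xs) = h (p @ ys)" for p
    using assms(2)
  proof (induction xs arbitrary: p ys)
    case (Cons x xs)
    then have "x \<in> set ys"
      by (metis list.set_intros(1) set_mset_mset)
    then obtain y1 y2 where ys: "ys = y1 @ x # y2"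
      by (meson split_list)
    then have "mset xs = mset (y1 @ y2)"
      using Cons.prems by simp
    from Cons.IH[OF this, of "p @ [x]"] show ?case
      using move[of p x y1 y2] ys by simp
  qed simp
  from this[of "[]"] show ?thesis by simp
qed

lemma symmetric_series_mset:
  assumes "symmetric_series f" and "mset xs = mset ys"
  shows "f (monomial xs) = f (monomial ys)"
proof (rule mset_invariant_if_swap_invariant[where h = "\<lambda>xs. f (monomial xs)", OF _ assms(2)])
  show "f (monomial (xs @ a # b # ys)) = f (monomial (xs @ b # a # ys))" for xs a b ys
    using assms(1) by (metis monomial_swap symmetric_series_def)
qed

section \<open>Partitions and a rank refining dominance order\<close>

definition partitions :: "nat \<Rightarrow> nat list set" where
  "partitions d = {\<nu>. is_partition \<nu> \<and> sum_list \<nu> = d}"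

text \<open>Sorting the exponents and pushing zeros to the end turns every monomial into that of a
  partition, so the coefficients at partitions determine a symmetric series.\<close>

lemma symmetric_series_eq_0:
  assumes sym: "symmetric_series f" and hom: "homogeneous d f"
    and zero: "\<And>\<nu>. \<nu> \<in> partitions d \<Longrightarrow> f (monomial \<nu>) = 0"
  shows "f M = 0"
proof (rule ccontr)
  assume nz: "f M \<noteq> 0"
  obtain xs where M: "M = monomial xs" using ex_monomial by blast
  define \<nu> where "\<nu> = rev (sort (filter (\<lambda>x. x \<noteq> 0) xs))"
  define m where "m = length (filter (\<lambda>x. x = 0) xs)"
  have "filter_mset (\<lambda>x. x = 0) (mset xs) = replicate_mset m 0"
    unfolding m_def by (induction xs) auto
  then have ms: "mset xs = mset (\<nu> @ replicate m 0)"
    using multiset_partition[of "mset xs" "\<lambda>x. x \<noteq> 0"] by (simp add: \<nu>_def)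
  then have eq: "f M = f (monomial \<nu>)"
    using symmetric_series_mset[OF sym ms] by (simp add: M monomial_append_zeros)
  have "sum_list \<nu> = d"
    using nz hom eq by (metis homogeneous_def size_monomial)
  moreover have "is_partition \<nu>"
    by (simp add: \<nu>_def is_partition_def sorted_wrt_rev)
  ultimately show False
    using zero nz eq by (simp add: partitions_def)
qed

lemma length_le_sum_list: "0 \<notin> set xs \<Longrightarrow> length xs \<le> sum_list (xs :: nat list)"
  by (induction xs) auto

lemma finite_partitions: "finite (partitions d)"
proof (rule finite_subset)
  show "partitions d \<subseteq> {xs. set xs \<subseteq> {..d} \<and> length xs \<le> d}"
    using length_le_sum_list by (auto simp: partitions_def is_partition_def member_le_sum_list)
  show "finite {xs. set xs \<subseteq> {..d} \<and> length xs \<le> d}"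
    by (rule finite_lists_length_le) simp
qed

text \<open>A numerical statistic that strictly increases along dominance, so triangularity
  arguments become inductions on a natural number. The cut-off at the sum loses nothing, since a
  partition of \<open>d\<close> has at most \<open>d\<close> parts.\<close>

definition dominance_rank :: "nat list \<Rightarrow> nat" where
  "dominance_rank \<nu> = (\<Sum>k\<le>sum_list \<nu>. sum_list (take k \<nu>))"

text \<open>If \<open>\<tau>\<close> were shorter, its partial sums would stall at its length while
  those of \<open>\<rho>\<close> still grow by a positive part.\<close>

lemma length_le_if_partial_sums_eq:
  assumes "0 \<notin> set \<rho>" and "\<And>k. k \<le> length \<rho> \<Longrightarrow> sum_list (take k \<tau>) = sum_list (take k \<rho>)"
  shows "length \<rho> \<le> length (\<tau> :: nat list)"
proof (rule ccontr)
  assume "\<not> ?thesis"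
  then have l: "length \<tau> < length \<rho>" by simp
  then have "sum_list (take (Suc (length \<tau>)) \<rho>) = sum_list (take (length \<tau>) \<rho>) + \<rho> ! length \<tau>"
    by (simp add: take_Suc_conv_app_nth)
  moreover have "sum_list (take (Suc (length \<tau>)) \<tau>) = sum_list (take (length \<tau>) \<tau>)"
    by simp
  moreover have "\<rho> ! length \<tau> \<noteq> 0"
    using l assms(1) by (metis nth_mem)
  ultimately show False
    using assms(2)[of "length \<tau>"] assms(2)[of "Suc (length \<tau>)"] l by simp
qed

text \<open>Dominance compares the partial sums termwise, so the reversed inequality of ranks forces
  all of them to agree; their differences are the parts.\<close>

lemma dominance_le_rank_eq:
  assumes "is_partition \<tau>" "is_partition \<rho>" "dominance_le \<tau> \<rho>"
    and "dominance_rank \<rho> \<le> dominance_rank \<tau>"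
  shows "\<tau> = \<rho>"
proof -
  define d where "d = sum_list \<rho>"
  have d: "sum_list \<tau> = d" "sum_list \<rho> = d"
    using assms(3) by (auto simp: dominance_le_def d_def)
  have le: "sum_list (take k \<tau>) \<le> sum_list (take k \<rho>)" for k
    using assms(3) by (simp add: dominance_le_def)
  have "(\<Sum>k\<le>d. sum_list (take k \<tau>)) \<le> (\<Sum>k\<le>d. sum_list (take k \<rho>))"
    by (rule sum_mono) (rule le)
  then have "(\<Sum>k\<le>d. sum_list (take k \<tau>)) = (\<Sum>k\<le>d. sum_list (take k \<rho>))"
    using assms(4) d by (simp add: dominance_rank_def)
  then have eq: "sum_list (take k \<tau>) = sum_list (take k \<rho>)" if "k \<le> d" for k
    by (rule sum_mono_inv[where I = "{..d}"]) (use le that in auto)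
  have len: "length \<tau> \<le> d" "length \<rho> \<le> d"
    using assms(1,2) d length_le_sum_list[of \<tau>] length_le_sum_list[of \<rho>]
    by (auto simp: is_partition_def)
  have "length \<rho> \<le> length \<tau>"
    by (rule length_le_if_partial_sums_eq)
      (use assms(2) len eq in \<open>auto simp: is_partition_def\<close>)
  moreover have "length \<tau> \<le> length \<rho>"
    by (rule length_le_if_partial_sums_eq)
      (use assms(1) len eq[symmetric] in \<open>auto simp: is_partition_def\<close>)
  ultimately have "length \<tau> = length \<rho>" by simp
  then show ?thesis
  proof (rule nth_equalityI)
    fix i assume i: "i < length \<tau>"
    then show "\<tau> ! i = \<rho> ! i"
      using eq[of i] eq[of "Suc i"] len \<open>length \<tau> = length \<rho>\<close>
      by (simp add: take_Suc_conv_app_nth)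
  qed
qed

section \<open>Existence and uniqueness of expansions in unitriangular families\<close>

definition unitriangular :: "(nat list \<Rightarrow> power_series) \<Rightarrow> bool" where
  "unitriangular b \<longleftrightarrow> (\<forall>\<rho>. is_partition \<rho> \<longrightarrow>
     symmetric_series (b \<rho>) \<and> homogeneous (sum_list \<rho>) (b \<rho>) \<and> b \<rho> (monomial \<rho>) = 1 \<and>
     (\<forall>\<tau>. is_partition \<tau> \<longrightarrow> b \<rho> (monomial \<tau>) \<noteq> 0 \<longrightarrow> dominance_le \<tau> \<rho>))"

lemma unitriangular_monomial:
  assumes "unitriangular b" "is_partition \<rho>" "is_partition \<tau>"
    and "dominance_rank \<rho> \<le> dominance_rank \<tau>"
  shows "b \<rho> (monomial \<tau>) = (if \<rho> = \<tau> then 1 else 0)"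
  using assms dominance_le_rank_eq[of \<tau> \<rho>] unfolding unitriangular_def by metis

text \<open>Elimination from the top: \<open>m\<close> bounds the ranks where coefficients may
  survive, and each induction step removes the layer of rank \<open>m\<close>.\<close>

lemma unitriangular_span:
  assumes b: "unitriangular b" and "symmetric_series f" "homogeneous d f"
    and "\<And>\<rho>. \<rho> \<in> partitions d \<Longrightarrow> m \<le> dominance_rank \<rho> \<Longrightarrow> f (monomial \<rho>) = 0"
  shows "\<exists>c. \<forall>M. f M = (\<Sum>\<nu>\<in>partitions d. c \<nu> * b \<nu> M)"
  using assms(2-)
proof (induction m arbitrary: f)
  case 0
  have "f M = 0" for M
    by (rule symmetric_series_eq_0[OF 0(1,2)]) (rule 0(3)[OF _ le0])
  then show ?case
    by (intro exI[of _ "\<lambda>_. 0"]) simp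
next
  case (Suc m)
  \<comment> \<open>Subtracting these multiples clears the coefficients of rank \<open>m\<close> and
    keeps those of higher rank zero: by \<open>unitriangular_monomial\<close>, a
    \<open>b \<rho>\<close> of rank \<open>m\<close> vanishes at every other partition of rank at
    least \<open>m\<close>.\<close>
  define a where "a \<rho> = (if dominance_rank \<rho> = m then f (monomial \<rho>) else 0)" for \<rho>
  define g where "g M = f M - (\<Sum>\<rho>\<in>partitions d. a \<rho> * b \<rho> M)" for M
  have par: "is_partition \<rho>" "sum_list \<rho> = d" if "\<rho> \<in> partitions d" for \<rho>
    using that by (auto simp: partitions_def)
  have "symmetric_series g"
    using Suc.prems(1) b par(1) unfolding symmetric_series_def unitriangular_def g_def
    by (auto intro!: arg_cong2[of _ _ _ _ "(-)"] sum.cong)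
  moreover have "homogeneous d g"
    unfolding homogeneous_def
  proof (intro allI impI)
    fix M assume "g M \<noteq> 0"
    then consider "f M \<noteq> 0" | "(\<Sum>\<rho>\<in>partitions d. a \<rho> * b \<rho> M) \<noteq> 0"
      unfolding g_def by fastforce
    then show "size M = d"
    proof cases
      case 1
      then show ?thesis using Suc.prems(2) by (simp add: homogeneous_def)
    next
      case 2
      then obtain \<rho> where "\<rho> \<in> partitions d" "b \<rho> M \<noteq> 0"
        by (metis (mono_tags, lifting) mult_zero_right sum.neutral)
      then show ?thesis
        using b par unfolding unitriangular_def homogeneous_def by metis
    qed
  qed
  moreover have "g (monomial \<tau>) = 0" if \<tau>: "\<tau> \<in> partitions d" "m \<le> dominance_rank \<tau>" for \<tau>
  proof -
    have "(\<Sum>\<rho>\<in>partitions d. a \<rho> * b \<rho> (monomial \<tau>)) = (\<Sum>\<rho>\<in>partitions d. if \<rho> = \<tau> then a \<tau> else 0)"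
    proof (rule sum.cong)
      fix \<rho> assume "\<rho> \<in> partitions d"
      then show "a \<rho> * b \<rho> (monomial \<tau>) = (if \<rho> = \<tau> then a \<tau> else 0)"
        using unitriangular_monomial[OF b, of \<rho> \<tau>] par \<tau> by (auto simp: a_def)
    qed simp
    then show ?thesis
      using \<tau> Suc.prems(3)[of \<tau>] finite_partitions by (auto simp: g_def a_def)
  qed
  ultimately obtain c where "\<And>M. g M = (\<Sum>\<nu>\<in>partitions d. c \<nu> * b \<nu> M)"
    using Suc.IH by blast
  then have "f M = (\<Sum>\<nu>\<in>partitions d. (c \<nu> + a \<nu>) * b \<nu> M)" for M
    unfolding g_def by (simp add: distrib_right sum.distrib diff_eq_eq)
  then show ?case by (intro exI[of _ "\<lambda>\<nu>. c \<nu> + a \<nu>"]) simp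
qed

lemma ex_expansion:
  assumes "unitriangular b" "symmetric_series f" "homogeneous d f"
  shows "\<exists>c. is_expansion b f c"
proof -
  have "\<rho> \<in> partitions d \<Longrightarrow> dominance_rank \<rho> \<le> Max (dominance_rank ` partitions d)" for \<rho>
    using finite_partitions by simp
  \<comment> \<open>With \<open>m\<close> above the largest rank the vanishing hypothesis is
    vacuous.\<close>
  then have "\<exists>c. \<forall>M. f M = (\<Sum>\<nu>\<in>partitions d. c \<nu> * b \<nu> M)"
    by (intro unitriangular_span[OF assms, of "Suc (Max (dominance_rank ` partitions d))"])
      (metis not_less_eq_eq)
  then obtain c where c: "\<And>M. f M = (\<Sum>\<nu>\<in>partitions d. c \<nu> * b \<nu> M)" by blast
  \<comment> \<open>Outside \<open>partitions d\<close> the function \<open>c\<close> is arbitrary,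
    whereas \<open>is_expansion\<close> fixes the support.\<close>
  define c' where "c' \<nu> = (if \<nu> \<in> partitions d then c \<nu> else 0)" for \<nu>
  have sub: "{\<nu>. c' \<nu> \<noteq> 0} \<subseteq> partitions d" by (auto simp: c'_def)
  have "f M = (\<Sum>\<nu> | c' \<nu> \<noteq> 0. c' \<nu> * b \<nu> M)" for M
    unfolding c by (rule sum.mono_neutral_cong_right[OF finite_partitions sub]) (auto simp: c'_def)
  moreover have "finite {\<nu>. c' \<nu> \<noteq> 0}"
    using sub finite_partitions finite_subset by blast
  ultimately have "is_expansion b f c'"
    using sub by (auto simp: is_expansion_def partitions_def)
  then show ?thesis by blast
qed

text \<open>At a partition \<open>\<tau>\<close> of maximal rank among those where the two
  expansions differ, all other terms of the difference vanish, so the coefficient there is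
  \<open>e \<tau>\<close>, which would have to be zero.\<close>

lemma expansion_unique:
  assumes b: "unitriangular b" and "is_expansion b f c" "is_expansion b f c'"
  shows "c = c'"
proof (rule ccontr)
  assume "c \<noteq> c'"
  define e where "e \<nu> = c \<nu> - c' \<nu>" for \<nu>
  define A where "A = {\<nu>. c \<nu> \<noteq> 0} \<union> {\<nu>. c' \<nu> \<noteq> 0}"
  have A: "finite A" "\<And>\<nu>. \<nu> \<in> A \<Longrightarrow> is_partition \<nu>"
    using assms(2,3) by (auto simp: A_def is_expansion_def)
  have zero: "(\<Sum>\<nu>\<in>A. e \<nu> * b \<nu> M) = 0" for M
  proof -
    have "f M = (\<Sum>\<nu> | c \<nu> \<noteq> 0. c \<nu> * b \<nu> M)" "f M = (\<Sum>\<nu> | c' \<nu> \<noteq> 0. c' \<nu> * b \<nu> M)"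
      using assms(2,3) unfolding is_expansion_def by blast+
    moreover have "(\<Sum>\<nu> | c \<nu> \<noteq> 0. c \<nu> * b \<nu> M) = (\<Sum>\<nu>\<in>A. c \<nu> * b \<nu> M)"
      by (rule sum.mono_neutral_left) (use A(1) in \<open>auto simp: A_def\<close>)
    moreover have "(\<Sum>\<nu> | c' \<nu> \<noteq> 0. c' \<nu> * b \<nu> M) = (\<Sum>\<nu>\<in>A. c' \<nu> * b \<nu> M)"
      by (rule sum.mono_neutral_left) (use A(1) in \<open>auto simp: A_def\<close>)
    ultimately show ?thesis
      by (simp add: e_def left_diff_distrib sum_subtractf)
  qed
  define B where "B = {\<nu> \<in> A. e \<nu> \<noteq> 0}"
  have "finite B" using A(1) by (simp add: B_def)
  obtain \<nu> where "c \<nu> \<noteq> c' \<nu>" using \<open>c \<noteq> c'\<close> by blast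
  then have "\<nu> \<in> B" by (auto simp: B_def A_def e_def)
  with \<open>finite B\<close> have "Max (dominance_rank ` B) \<in> dominance_rank ` B"
    by (intro Max_in) auto
  then obtain \<tau> where \<tau>: "\<tau> \<in> B" "dominance_rank \<tau> = Max (dominance_rank ` B)" by auto
  then have max: "dominance_rank \<rho> \<le> dominance_rank \<tau>" if "\<rho> \<in> B" for \<rho>
    using that \<open>finite B\<close> by simp
  have "(\<Sum>\<nu>\<in>A. e \<nu> * b \<nu> (monomial \<tau>)) = (\<Sum>\<nu>\<in>A. if \<nu> = \<tau> then e \<tau> else 0)"
  proof (rule sum.cong)
    fix \<nu> assume "\<nu> \<in> A"
    then show "e \<nu> * b \<nu> (monomial \<tau>) = (if \<nu> = \<tau> then e \<tau> else 0)"
      using unitriangular_monomial[OF b, of \<nu> \<tau>] A(2) \<tau>(1) max[of \<nu>]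
      by (cases "e \<nu> = 0") (auto simp: B_def)
  qed simp
  also have "\<dots> = e \<tau>" using A(1) \<tau>(1) by (simp add: B_def)
  finally show False using zero \<tau>(1) by (simp add: B_def)
qed

lemma basis_coeff_eq:
  assumes "unitriangular b" "is_expansion b f c"
  shows "basis_coeff b \<nu> f = c \<nu>"
proof -
  have "(THE c. is_expansion b f c) = c"
    using assms expansion_unique by blast
  then show ?thesis by (simp add: basis_coeff_def)
qed

section \<open>The monomial basis\<close>

lemma exponents_monomial:
  "image_mset (count (monomial xs)) (mset_set (set_mset (monomial xs)))
    = filter_mset (\<lambda>x. x \<noteq> 0) (mset xs)"
proof -
  have "set_mset (monomial xs) = {i \<in> {0..<length xs}. xs ! i \<noteq> 0}"
    by (auto simp: set_mset_def count_monomial)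
  then have "mset_set (set_mset (monomial xs))
      = filter_mset (\<lambda>i. xs ! i \<noteq> 0) (mset_set {0..<length xs})"
    by simp
  then have "image_mset (count (monomial xs)) (mset_set (set_mset (monomial xs)))
      = image_mset ((!) xs) (filter_mset (\<lambda>i. xs ! i \<noteq> 0) (mset_set {0..<length xs}))"
    by (simp only:) (rule image_mset_cong, simp add: count_monomial)
  also have "\<dots> = filter_mset (\<lambda>x. x \<noteq> 0) (image_mset ((!) xs) (mset_set {0..<length xs}))"
    by (simp add: filter_mset_image_mset)
  also have "image_mset ((!) xs) (mset_set {0..<length xs}) = mset xs"
    by (metis map_nth mset_map mset_upt)
  finally show ?thesis .
qed

lemma exponents_transpose:
  "image_mset (count (image_mset (Transposition.transpose a b) M))
      (mset_set (set_mset (image_mset (Transposition.transpose a b) M)))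
    = image_mset (count M) (mset_set (set_mset M))"
proof -
  have "mset_set (Transposition.transpose a b ` set_mset M)
      = image_mset (Transposition.transpose a b) (mset_set (set_mset M))"
    by (simp add: image_mset_mset_set)
  then show ?thesis
    by (simp add: multiset.map_comp comp_def count_image_mset_transpose)
qed

lemma size_eq_sum_exponents:
  "size M = sum_mset (image_mset (count M) (mset_set (set_mset M)))"
  by (simp add: size_multiset_overloaded_eq sum_unfold_sum_mset)

lemma is_partition_mset_eq:
  assumes "is_partition \<mu>" "is_partition \<nu>" "mset \<mu> = mset \<nu>"
  shows "\<mu> = \<nu>"
proof -
  have "sorted (rev \<mu>)" "sorted (rev \<nu>)"
    using assms by (auto simp: is_partition_def sorted_wrt_rev)
  then have "rev \<mu> = rev \<nu>"
    using assms(3) by (metis mset_rev properties_for_sort)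
  then show ?thesis by simp
qed

lemma monomial_sym_monomial:
  assumes "is_partition \<mu>" "is_partition \<nu>"
  shows "monomial_sym \<nu> (monomial \<mu>) = (if \<mu> = \<nu> then 1 else 0)"
proof -
  have "filter_mset (\<lambda>x. x \<noteq> 0) (mset \<mu>) = mset \<mu>"
    using assms(1) by (auto simp: is_partition_def filter_mset_eq_conv intro: gr0I)
  then show ?thesis
    using assms is_partition_mset_eq unfolding monomial_sym_def exponents_monomial by auto
qed

lemma unitriangular_monomial_sym: "unitriangular monomial_sym"
proof -
  have "symmetric_series (monomial_sym \<nu>)" for \<nu>
    by (simp add: symmetric_series_def monomial_sym_def exponents_transpose
        del: set_image_mset)
  moreover have "homogeneous (sum_list \<nu>) (monomial_sym \<nu>)" for \<nu>
    by (auto simp: homogeneous_def monomial_sym_def sum_mset_sum_list size_eq_sum_exponents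
        split: if_splits)
  moreover have "dominance_le \<nu> \<nu>" for \<nu>
    by (simp add: dominance_le_def)
  ultimately show ?thesis
    by (auto simp: unitriangular_def monomial_sym_monomial split: if_splits)
qed

text \<open>Reduces strong niceness to a comparison of plain power series coefficients, that is, of
  numbers of colorings.\<close>

lemma basis_coeff_monomial_sym:
  assumes "symmetric_series f" "homogeneous d f" "is_partition \<mu>"
  shows "basis_coeff monomial_sym \<mu> f = f (monomial \<mu>)"
proof -
  obtain c where c: "is_expansion monomial_sym f c"
    using ex_expansion unitriangular_monomial_sym assms by blast
  then have "f (monomial \<mu>) = (\<Sum>\<nu> | c \<nu> \<noteq> 0. c \<nu> * monomial_sym \<nu> (monomial \<mu>))"
    by (simp add: is_expansion_def)
  also have "\<dots> = (\<Sum>\<nu> | c \<nu> \<noteq> 0. if \<nu> = \<mu> then c \<mu> else 0)"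
    using c assms(3) by (intro sum.cong) (auto simp: is_expansion_def monomial_sym_monomial)
  also have "\<dots> = c \<mu>"
    using c by (simp add: is_expansion_def)
  finally show ?thesis
    using basis_coeff_eq[OF unitriangular_monomial_sym c] by simp
qed

lemma strongly_nice_monomial:
  assumes "strongly_nice V E" "symmetric_series (chromatic_sym V E)"
    and "homogeneous d (chromatic_sym V E)"
    and "is_partition \<mu>" "is_partition \<nu>" "dominance_le \<mu> \<nu>"
  shows "chromatic_sym V E (monomial \<nu>) \<le> chromatic_sym V E (monomial \<mu>)"
proof -
  have "basis_coeff monomial_sym \<nu> (chromatic_sym V E) \<le> basis_coeff monomial_sym \<mu> (chromatic_sym V E)"
    using assms(1,4-6) unfolding strongly_nice_def by blast
  then show ?thesis
    using basis_coeff_monomial_sym[OF assms(2,3)] assms(4,5) by simp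
qed

section \<open>Schur functions and Gelfand--Tsetlin patterns\<close>

text \<open>Padding with zeros lets the inequalities of a pattern hold for all row indices without
  case distinctions.\<close>

definition part :: "nat list \<Rightarrow> nat \<Rightarrow> nat" where
  "part \<nu> i = (if i < length \<nu> then \<nu> ! i else 0)"

text \<open>Level \<open>k\<close> records the row lengths of the subtableau of entries below
  \<open>k\<close>. Levels run over all naturals, so no number of variables is fixed; the sum
  condition encodes the content, and interlacing encodes strict columns.\<close>

definition gt_patterns :: "nat list \<Rightarrow> nat multiset \<Rightarrow> (nat \<Rightarrow> nat \<Rightarrow> nat) set" where
  "gt_patterns \<nu> M = {g. (\<forall>i. g 0 i = 0) \<and> (\<forall>k i. g k i \<le> g (Suc k) i) \<and>
     (\<forall>k i. g (Suc k) (Suc i) \<le> g k i) \<and> (\<forall>k i. g k i \<le> part \<nu> i) \<and>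
     (\<forall>k. (\<Sum>i<length \<nu>. g k i) = (\<Sum>c<k. count M c))}"

lemma cells_iff: "(i, j) \<in> cells \<nu> \<longleftrightarrow> j < part \<nu> i"
  by (auto simp: cells_def part_def)

lemma cells_Sigma: "cells \<nu> = (SIGMA i:{..<length \<nu>}. {..<part \<nu> i})"
  by (auto simp: cells_def part_def)

lemma finite_cells: "finite (cells \<nu>)"
  by (simp add: cells_Sigma)

lemma sum_part: "(\<Sum>i<length \<nu>. part \<nu> i) = sum_list \<nu>"
  by (simp add: part_def sum_list_sum_nth atLeast0LessThan)

lemma card_cells: "card (cells \<nu>) = sum_list \<nu>"
  by (simp add: cells_Sigma card_SigmaI sum_part)

lemma part_antimono:
  assumes "is_partition \<nu>" "i \<le> j"
  shows "part \<nu> j \<le> part \<nu> i"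
  using assms sorted_wrt_nth_less[of "(\<ge>)" \<nu> i j]
  by (cases "i = j") (auto simp: part_def is_partition_def)

lemma sum_count_lessThan: "(\<Sum>c<k. count M c) = size (filter_mset (\<lambda>c. c < (k::nat)) M)"
proof (induction k)
  case (Suc k)
  have "filter_mset (\<lambda>c. c < Suc k) M = filter_mset (\<lambda>c. c < k) M + replicate_mset (count M k) k"
    by (rule multiset_eqI) auto
  then show ?case using Suc by simp
qed simp

lemma multiset_eq_if_partial_sums_eq:
  assumes "\<And>k. (\<Sum>c<k. count M c) = (\<Sum>c<(k::nat). count N c)"
  shows "M = N"
proof (rule multiset_eqI)
  fix c show "count M c = count N c"
    using assms[of c] assms[of "Suc c"] by simp
qed

lemma ex_bound_mset: "\<exists>K. \<forall>c\<in>#M. c < (K::nat)"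
  using finite_nat_set_iff_bounded by blast

lemma gt_patterns_mono:
  assumes "g \<in> gt_patterns \<nu> M" "k \<le> l"
  shows "g k i \<le> g l i"
  using assms(1) by (intro lift_Suc_mono_le[OF _ assms(2)]) (auto simp: gt_patterns_def)

text \<open>Past the largest variable of \<open>M\<close> a level has total
  \<open>sum_list \<nu>\<close> while each row is bounded by its part, so every row is full.\<close>

lemma gt_patterns_eventually:
  assumes g: "g \<in> gt_patterns \<nu> M" and "size M = sum_list \<nu>"
  shows "\<exists>k. g k i = part \<nu> i"
proof -
  obtain K where "\<forall>c\<in>#M. c < K" using ex_bound_mset by blast
  then have "filter_mset (\<lambda>c. c < K) M = M" by (simp add: filter_mset_eq_conv)
  then have "(\<Sum>i<length \<nu>. g K i) = (\<Sum>i<length \<nu>. part \<nu> i)"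
    using g assms(2) by (simp add: gt_patterns_def sum_count_lessThan sum_part)
  moreover have le: "g K i \<le> part \<nu> i" for i
    using g by (simp add: gt_patterns_def)
  ultimately have "g K i = part \<nu> i" if "i < length \<nu>"
    using sum_mono_inv[of "g K" "{..<length \<nu>}" "part \<nu>" i] that by simp
  moreover have "g K i = part \<nu> i" if "\<not> i < length \<nu>"
    using le[of i] that by (simp add: part_def)
  ultimately show ?thesis by blast
qed

text \<open>In tableau terms: strict columns force the entries of row \<open>i\<close> to be at
  least \<open>i\<close>. Interlacing carries the zeros of level 0 down one row per level.\<close>

lemma gt_patterns_zero:
  assumes g: "g \<in> gt_patterns \<nu> M" and "k \<le> i"
  shows "g k i = 0"
  using assms(2)
proof (induction k arbitrary: i)
  case 0
  then show ?case using g by (simp add: gt_patterns_def)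
next
  case (Suc k)
  then obtain i' where i': "i = Suc i'" "k \<le> i'" by (cases i) auto
  have "g (Suc k) (Suc i') \<le> g k i'" using g by (simp add: gt_patterns_def)
  then show ?case using Suc.IH i' by simp
qed

section \<open>Semistandard tableaux and patterns are in bijection\<close>

definition pattern_of :: "nat list \<Rightarrow> (nat \<times> nat \<Rightarrow> nat) \<Rightarrow> nat \<Rightarrow> nat \<Rightarrow> nat" where
  "pattern_of \<nu> T k i = card {j. j < part \<nu> i \<and> T (i, j) < k}"

definition tableaux_with_content :: "nat list \<Rightarrow> nat multiset \<Rightarrow> (nat \<times> nat \<Rightarrow> nat) set" where
  "tableaux_with_content \<nu> M =
     {T \<in> semistandard_tableaux \<nu>. image_mset T (mset_set (cells \<nu>)) = M}"

lemma down_closed_eq_lessThan_card: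
  assumes "finite A" "\<And>i j. j \<in> A \<Longrightarrow> i < j \<Longrightarrow> i \<in> A"
  shows "A = {..<card (A :: nat set)}"
  using assms
proof (cases "A = {}")
  case False
  then have "Max A \<in> A"
    using assms(1) by simp
  then have "A = {..Max A}"
    using assms Max_ge[OF assms(1)] by (auto simp: le_less)
  then show ?thesis
    by (metis card_atMost lessThan_Suc_atMost)
qed simp

text \<open>Rows increase weakly, so the cells with entry below \<open>k\<close> form an initial
  segment of their row, and its length remembers the set.\<close>

lemma less_pattern_of:
  assumes "T \<in> semistandard_tableaux \<nu>"
  shows "j < pattern_of \<nu> T k i \<longleftrightarrow> j < part \<nu> i \<and> T (i, j) < k"
proof -
  let ?A = "{j. j < part \<nu> i \<and> T (i, j) < k}"
  have row: "T (i, j) \<le> T (i, j')" if "j' < part \<nu> i" "j < j'" for j j'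
    using assms that by (auto simp: semistandard_tableaux_def cells_iff)
  have "?A = {..<card ?A}"
    using row by (intro down_closed_eq_lessThan_card) (auto intro: le_less_trans)
  then show ?thesis
    unfolding pattern_of_def by blast
qed

lemma sum_pattern_of:
  "(\<Sum>i<length \<nu>. pattern_of \<nu> T k i)
    = (\<Sum>c<k. count (image_mset T (mset_set (cells \<nu>))) c)"
proof -
  have "{x \<in> cells \<nu>. T x < k} = (SIGMA i:{..<length \<nu>}. {j. j < part \<nu> i \<and> T (i, j) < k})"
    by (auto simp: cells_Sigma)
  then have "(\<Sum>i<length \<nu>. pattern_of \<nu> T k i) = card {x \<in> cells \<nu>. T x < k}"
    by (simp add: pattern_of_def card_SigmaI)
  also have "\<dots> = (\<Sum>c<k. count (image_mset T (mset_set (cells \<nu>))) c)"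
    by (simp add: sum_count_lessThan filter_mset_image_mset finite_cells)
  finally show ?thesis .
qed

lemma pattern_of_gt_patterns:
  assumes "is_partition \<nu>" and T: "T \<in> tableaux_with_content \<nu> M"
  shows "pattern_of \<nu> T \<in> gt_patterns \<nu> M"
proof -
  have S: "T \<in> semistandard_tableaux \<nu>"
    and M: "image_mset T (mset_set (cells \<nu>)) = M"
    using T by (auto simp: tableaux_with_content_def)
  note less = less_pattern_of[OF S]
  have le: "a \<le> b" if "\<And>j. j < a \<Longrightarrow> j < b" for a b :: nat
    using that[of b] by fastforce
  have col: "T (i, j) < T (Suc i, j)" if "j < part \<nu> (Suc i)" for i j
    using S that part_antimono[OF assms(1), of i "Suc i"]
    by (auto simp: semistandard_tableaux_def cells_iff)
  have "pattern_of \<nu> T 0 i = 0" for i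
    by (simp add: pattern_of_def)
  moreover have "pattern_of \<nu> T k i \<le> pattern_of \<nu> T (Suc k) i" for k i
    by (rule le) (auto simp: less)
  moreover have "pattern_of \<nu> T (Suc k) (Suc i) \<le> pattern_of \<nu> T k i" for k i
  proof (rule le)
    fix j assume "j < pattern_of \<nu> T (Suc k) (Suc i)"
    then show "j < pattern_of \<nu> T k i"
      using col[of j i] part_antimono[OF assms(1), of i "Suc i"] by (auto simp: less)
  qed
  moreover have "pattern_of \<nu> T k i \<le> part \<nu> i" for k i
    by (rule le) (auto simp: less)
  ultimately show ?thesis
    using sum_pattern_of[of \<nu> T] M by (simp add: gt_patterns_def)
qed

lemma inj_on_pattern_of: "inj_on (pattern_of \<nu>) (semistandard_tableaux \<nu>)"
proof (rule inj_onI)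
  fix T T' assume T: "T \<in> semistandard_tableaux \<nu>" "T' \<in> semistandard_tableaux \<nu>"
    and eq: "pattern_of \<nu> T = pattern_of \<nu> T'"
  have ext: "T \<in> extensional (cells \<nu>)" "T' \<in> extensional (cells \<nu>)"
    using T by (auto simp: semistandard_tableaux_def PiE_def)
  show "T = T'"
  proof (rule extensionalityI[OF ext])
    fix x assume "x \<in> cells \<nu>"
    then obtain i j where x: "x = (i, j)" "j < part \<nu> i" by (cases x) (auto simp: cells_iff)
    have "T (i, j) < k \<longleftrightarrow> T' (i, j) < k" for k
      using less_pattern_of[OF T(1), of j k i] less_pattern_of[OF T(2), of j k i] eq x(2) by simp
    then show "T x = T' x"
      by (metis less_irrefl linorder_neqE_nat x(1))
  qed
qed

text \<open>The inverse construction: every pattern of the right size is read back as a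
  tableau.\<close>

lemma ex_tableau_of_pattern:
  assumes "is_partition \<nu>" and g: "g \<in> gt_patterns \<nu> M" and M: "size M = sum_list \<nu>"
  shows "\<exists>T \<in> tableaux_with_content \<nu> M. pattern_of \<nu> T = g"
proof -
  have g0: "g 0 i = 0" and inter: "g (Suc k) (Suc i) \<le> g k i" and le: "g k i \<le> part \<nu> i"
    and sum: "(\<Sum>i<length \<nu>. g k i) = (\<Sum>c<k. count M c)" for i k
    using g by (auto simp: gt_patterns_def)
  \<comment> \<open>A cell receives the number of the step at which its row first grows over it. The
    \<open>Suc\<close> appears because level \<open>Suc k\<close> holds the entries up to and
    including \<open>k\<close>.\<close>
  define T where "T = (\<lambda>(i, j)\<in>cells \<nu>. LEAST k. j < g (Suc k) i)"
  have less: "T (i, j) < k \<longleftrightarrow> j < g k i" if j: "j < part \<nu> i" for i j k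
  proof -
    have T: "T (i, j) = (LEAST k. j < g (Suc k) i)"
      using j by (simp add: T_def cells_iff)
    obtain l where "g l i = part \<nu> i"
      using gt_patterns_eventually[OF g M] by blast
    then have "\<exists>m. j < g (Suc m) i"
      using j g0[of i] by (metis not0_implies_Suc not_less_zero)
    then obtain m where "j < g (Suc m) i" by blast
    then have L: "j < g (Suc (T (i, j))) i"
      unfolding T by (rule LeastI)
    show ?thesis
    proof
      assume "T (i, j) < k"
      then show "j < g k i"
        using L gt_patterns_mono[OF g, of "Suc (T (i, j))" k i] by simp
    next
      assume jk: "j < g k i"
      then obtain k' where k: "k = Suc k'"
        using jk g0[of i] by (cases k) auto
      then show "T (i, j) < k"
        unfolding T using jk Least_le[of "\<lambda>k. j < g (Suc k) i" k'] by simp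
    qed
  qed
  \<comment> \<open>Interlacing concerns neighbouring rows only, while the tableau condition
    compares any two rows; monotonicity in the level bridges the gap.\<close>
  have drop: "g (Suc k) i' \<le> g k i" if "i < i'" for i i' k
    using that
  proof (induction i')
    case (Suc i')
    have "g (Suc k) (Suc i') \<le> g k i'" by (rule inter)
    moreover have "g k i' \<le> g (Suc k) i'"
      by (rule gt_patterns_mono[OF g]) simp
    ultimately show ?case using Suc by (cases "i = i'") auto
  qed simp
  have row: "T (i, j) \<le> T (i, j')" if "j' < part \<nu> i" "j < j'" for i j j'
    using less[of j' i "Suc (T (i, j'))"] less[of j i "Suc (T (i, j'))"] that by simp
  have col: "T (i, j) < T (i', j)" if "j < part \<nu> i" "j < part \<nu> i'" "i < i'" for i i' j
  proof -
    have "j < g (Suc (T (i', j))) i'" using less that(2) by blast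
    then have "j < g (T (i', j)) i" using drop[OF that(3)] by (meson less_le_trans)
    then show ?thesis using less that(1) by blast
  qed
  have "T \<in> cells \<nu> \<rightarrow>\<^sub>E UNIV" by (simp add: T_def)
  then have S: "T \<in> semistandard_tableaux \<nu>"
    using row col by (simp add: semistandard_tableaux_def cells_iff)
  have pat: "pattern_of \<nu> T = g"
  proof (intro ext)
    fix k i
    have "{j. j < part \<nu> i \<and> T (i, j) < k} = {..<g k i}"
      using less le[of k i] by auto
    then show "pattern_of \<nu> T k i = g k i" by (simp add: pattern_of_def)
  qed
  have "image_mset T (mset_set (cells \<nu>)) = M"
    using sum_pattern_of[of \<nu> T] sum pat by (intro multiset_eq_if_partial_sums_eq) simp
  then show ?thesis
    using S pat by (auto simp: tableaux_with_content_def)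
qed

lemma size_tableau_content:
  assumes "T \<in> tableaux_with_content \<nu> M"
  shows "size M = sum_list \<nu>"
  using assms by (auto simp: tableaux_with_content_def card_cells)

lemma bij_betw_pattern_of:
  assumes "is_partition \<nu>" "size M = sum_list \<nu>"
  shows "bij_betw (pattern_of \<nu>) (tableaux_with_content \<nu> M) (gt_patterns \<nu> M)"
  unfolding bij_betw_def
proof
  show "inj_on (pattern_of \<nu>) (tableaux_with_content \<nu> M)"
    by (rule inj_on_subset[OF inj_on_pattern_of]) (auto simp: tableaux_with_content_def)
  show "pattern_of \<nu> ` tableaux_with_content \<nu> M = gt_patterns \<nu> M"
    using pattern_of_gt_patterns ex_tableau_of_pattern assms by blast
qed

lemma homogeneous_schur: "homogeneous (sum_list \<nu>) (schur \<nu>)"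
  unfolding homogeneous_def schur_def
proof (intro allI impI)
  fix M assume "int (card {T \<in> semistandard_tableaux \<nu>. image_mset T (mset_set (cells \<nu>)) = M}) \<noteq> 0"
  then have "tableaux_with_content \<nu> M \<noteq> {}"
    unfolding tableaux_with_content_def by (metis card.empty of_nat_0)
  then obtain T where "T \<in> tableaux_with_content \<nu> M"
    by blast
  then show "size M = sum_list \<nu>" by (rule size_tableau_content)
qed

lemma schur_eq_card_gt_patterns:
  assumes "is_partition \<nu>" "size M = sum_list \<nu>"
  shows "schur \<nu> M = int (card (gt_patterns \<nu> M))"
  using bij_betw_same_card[OF bij_betw_pattern_of[OF assms]]
  by (simp add: schur_def tableaux_with_content_def)

text \<open>Finiteness is transferred from tableaux, which are functions from finitely many cells to
  the finite set of variables of \<open>M\<close>.\<close>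

lemma finite_gt_patterns:
  assumes "is_partition \<nu>" "size M = sum_list \<nu>"
  shows "finite (gt_patterns \<nu> M)"
proof -
  have "tableaux_with_content \<nu> M \<subseteq> cells \<nu> \<rightarrow>\<^sub>E set_mset M"
    using finite_cells by (auto simp: tableaux_with_content_def semistandard_tableaux_def)
  then have "finite (tableaux_with_content \<nu> M)"
    by (rule finite_subset) (simp add: finite_PiE finite_cells)
  then show ?thesis
    using bij_betw_finite[OF bij_betw_pattern_of[OF assms]] by simp
qed

text \<open>
  The Bender--Knuth involution: fixing the other levels of a pattern, the entries at level
  \<open>Suc c\<close> range independently over intervals, and each is reflected in its interval.
\<close>

definition lower :: "nat \<Rightarrow> (nat \<Rightarrow> nat \<Rightarrow> nat) \<Rightarrow> nat \<Rightarrow> nat" where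
  "lower c g i = max (g (Suc (Suc c)) (Suc i)) (g c i)"

text \<open>Row 0 has no row above it, so only level \<open>Suc (Suc c)\<close> bounds it.\<close>

definition upper :: "nat \<Rightarrow> (nat \<Rightarrow> nat \<Rightarrow> nat) \<Rightarrow> nat \<Rightarrow> nat" where
  "upper c g i = (if i = 0 then g (Suc (Suc c)) 0 else min (g (Suc (Suc c)) i) (g c (i - 1)))"

definition reflect :: "nat \<Rightarrow> (nat \<Rightarrow> nat \<Rightarrow> nat) \<Rightarrow> nat \<Rightarrow> nat \<Rightarrow> nat" where
  "reflect c g = g(Suc c := \<lambda>i. lower c g i + upper c g i - g (Suc c) i)"

lemma gt_patterns_bounds:
  assumes "g \<in> gt_patterns \<nu> M"
  shows "lower c g i \<le> g (Suc c) i" "g (Suc c) i \<le> upper c g i"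
  using assms by (cases i; auto simp: gt_patterns_def lower_def upper_def)+

text \<open>\<open>lower\<close> at row \<open>i\<close> and \<open>upper\<close> at row
  \<open>Suc i\<close> are the maximum and the minimum of the same two numbers, so together they
  give their sum. Row 0 and row \<open>L\<close> supply the boundary terms.\<close>

lemma sum_lower_upper:
  "(\<Sum>i<L. lower c g i + upper c g i) + upper c g L
    = (\<Sum>i<L. g c i) + (\<Sum>i<Suc L. g (Suc (Suc c)) i)"
  by (induction L) (auto simp: lower_def upper_def)

text \<open>Staying within the intervals preserves the inequalities. The new total of level
  \<open>Suc c\<close> is the sum of the totals of its two neighbours minus the old total, which
  exchanges the multiplicities of \<open>c\<close> and \<open>Suc c\<close>.\<close>

lemma reflect_gt_patterns:
  assumes g: "g \<in> gt_patterns \<nu> M"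
  shows "reflect c g \<in> gt_patterns \<nu> (image_mset (Transposition.transpose c (Suc c)) M)"
proof -
  let ?N = "image_mset (Transposition.transpose c (Suc c)) M"
  have g0: "g 0 i = 0" and mono: "g k i \<le> g (Suc k) i" and inter: "g (Suc k) (Suc i) \<le> g k i"
    and le: "g k i \<le> part \<nu> i"
    and sum: "(\<Sum>i<length \<nu>. g k i) = (\<Sum>c<k. count M c)" for i k
    using g by (auto simp: gt_patterns_def)
  note b = gt_patterns_bounds[OF g, of c]
  define h where "h i = lower c g i + upper c g i - g (Suc c) i" for i
  have h: "lower c g i \<le> h i" "h i \<le> upper c g i" for i
    using b[of i] by (auto simp: h_def)
  have r: "reflect c g k = (if k = Suc c then h else g k)" for k
    by (auto simp: reflect_def h_def)
  have hb: "g c i \<le> h i" "h i \<le> g (Suc (Suc c)) i" "g (Suc (Suc c)) (Suc i) \<le> h i"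
    "h (Suc i) \<le> g c i" for i
    using h[of i] h[of "Suc i"] by (auto simp: lower_def upper_def split: if_splits)
  have "h i \<le> part \<nu> i" for i
    using hb(2) le order_trans by blast
  moreover have "(\<Sum>i<length \<nu>. reflect c g k i) = (\<Sum>c<k. count ?N c)" for k
  proof (cases "k = Suc c")
    case True
    have "(\<Sum>i<length \<nu>. h i) + (\<Sum>i<length \<nu>. g (Suc c) i)
        = (\<Sum>i<length \<nu>. lower c g i + upper c g i)"
      using b(2) by (simp add: h_def flip: sum.distrib) (simp add: trans_le_add2)
    also have "\<dots> = (\<Sum>i<length \<nu>. g c i) + (\<Sum>i<length \<nu>. g (Suc (Suc c)) i)"
    proof -
      \<comment> \<open>This removes the boundary terms of \<open>sum_lower_upper\<close>.\<close>
      have "g (Suc (Suc c)) (length \<nu>) = 0"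
        using le[of "Suc (Suc c)" "length \<nu>"] by (simp add: part_def)
      then show ?thesis
        using sum_lower_upper[of c g "length \<nu>"] by (simp add: upper_def split: if_splits)
    qed
    finally have "(\<Sum>i<length \<nu>. h i) = (\<Sum>c<c. count M c) + count M (Suc c)"
      by (simp add: sum)
    moreover have "(\<Sum>d<c. count ?N d) = (\<Sum>d<c. count M d)"
      by (rule sum.cong) (auto simp: count_image_mset_transpose Transposition.transpose_def)
    ultimately show ?thesis
      using True by (simp add: r count_image_mset_transpose)
  next
    case False
    have "(\<Sum>d<k. count ?N d) = (\<Sum>d<k. count M d)"
    proof (cases "k \<le> c")
      case True
      then show ?thesis
        by (intro sum.cong) (auto simp: count_image_mset_transpose Transposition.transpose_def)
    next
      case k: False
      then have "Suc c < k" using \<open>k \<noteq> Suc c\<close> by simp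
      \<comment> \<open>Both exchanged variables lie below \<open>k\<close>, so the partial sum is
        merely permuted.\<close>
      then have "bij_betw (Transposition.transpose c (Suc c)) {..<k} {..<k}"
        by (intro bij_betw_byWitness[where f' = "Transposition.transpose c (Suc c)"])
          (auto simp: Transposition.transpose_def)
      then show ?thesis
        using sum.reindex_bij_betw[of _ "{..<k}" "{..<k}" "count M"]
        by (simp add: count_image_mset_transpose)
    qed
    then show ?thesis using False by (simp add: r sum)
  qed
  ultimately show ?thesis
    using g0 mono inter le hb by (auto simp: gt_patterns_def r)
qed

text \<open>The intervals depend only on levels \<open>c\<close> and \<open>Suc (Suc c)\<close>,
  which the reflection leaves alone.\<close>

lemma reflect_reflect:
  assumes "g \<in> gt_patterns \<nu> M"
  shows "reflect c (reflect c g) = g"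
proof -
  have "lower c (reflect c g) = lower c g" "upper c (reflect c g) = upper c g"
    by (auto simp: fun_eq_iff lower_def upper_def reflect_def)
  then show ?thesis
    using gt_patterns_bounds(2)[OF assms, of c]
    by (auto simp: reflect_def fun_eq_iff trans_le_add2)
qed

lemma symmetric_schur:
  assumes "is_partition \<nu>"
  shows "symmetric_series (schur \<nu>)"
  unfolding symmetric_series_def
proof (intro allI)
  fix c M
  let ?t = "Transposition.transpose c (Suc c)"
  show "schur \<nu> (image_mset ?t M) = schur \<nu> M"
  proof (cases "size M = sum_list \<nu>")
    case True
    have M: "image_mset ?t (image_mset ?t M) = M"
      by (simp add: multiset.map_comp)
    have "bij_betw (reflect c) (gt_patterns \<nu> M) (gt_patterns \<nu> (image_mset ?t M))"
      using reflect_gt_patterns[of _ \<nu> M c] reflect_gt_patterns[of _ \<nu> "image_mset ?t M" c]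
        reflect_reflect M
      by (intro bij_betw_byWitness[where f' = "reflect c"]) auto
    then show ?thesis
      using True assms by (simp add: schur_eq_card_gt_patterns bij_betw_same_card)
  next
    case False
    then show ?thesis
      using homogeneous_schur[of \<nu>] by (metis homogeneous_def size_image_mset)
  qed
qed

section \<open>Unitriangularity of the Schur functions\<close>

lemma sum_take_eq_sum_part: "sum_list (take k \<nu>) = (\<Sum>i<k. part \<nu> i)"
proof (induction k)
  case (Suc k)
  then show ?case
    by (cases "k < length \<nu>") (auto simp: take_Suc_conv_app_nth part_def)
qed simp

lemma count_monomial_part: "count (monomial \<tau>) c = part \<tau> c"
  by (simp add: count_monomial part_def)

text \<open>Level \<open>k\<close> is supported on rows below both \<open>k\<close> and
  \<open>length \<nu>\<close>, so either range gives the same total. This is the source of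
  dominance: the left side is bounded by a partial sum of \<open>\<nu>\<close>.\<close>

lemma sum_gt_patterns_lessThan:
  assumes g: "g \<in> gt_patterns \<nu> (monomial \<tau>)"
  shows "(\<Sum>i<k. g k i) = sum_list (take k \<tau>)"
proof -
  have le: "g k i \<le> part \<nu> i" for i
    using g by (simp add: gt_patterns_def)
  have "g k i = 0" if "length \<nu> \<le> i" for i
    using le[of i] that by (simp add: part_def)
  then have "(\<Sum>i<length \<nu>. g k i) = (\<Sum>i<max k (length \<nu>). g k i)"
    by (intro sum.mono_neutral_left) auto
  moreover have "(\<Sum>i<k. g k i) = (\<Sum>i<max k (length \<nu>). g k i)"
    using gt_patterns_zero[OF g] by (intro sum.mono_neutral_left) auto
  ultimately have "(\<Sum>i<k. g k i) = (\<Sum>i<length \<nu>. g k i)"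
    by simp
  then show ?thesis
    using g by (simp add: gt_patterns_def sum_take_eq_sum_part count_monomial_part)
qed

text \<open>At level \<open>k\<close> the first \<open>k\<close> rows must hold as much as the first
  \<open>k\<close> parts of \<open>\<nu>\<close>, which leaves no freedom: each of them is
  full.\<close>

lemma gt_patterns_self:
  assumes "is_partition \<nu>"
  shows "gt_patterns \<nu> (monomial \<nu>) = {\<lambda>k i. if i < k then part \<nu> i else 0}" (is "_ = {?g}")
proof -
  have "?g \<in> gt_patterns \<nu> (monomial \<nu>)"
  proof -
    have "(\<Sum>i<length \<nu>. ?g k i) = (\<Sum>i<k. part \<nu> i)" for k
      by (intro sum.mono_neutral_cong) (auto simp: part_def)
    then show ?thesis
      using part_antimono[OF assms]
      by (simp add: gt_patterns_def count_monomial_part)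
  qed
  moreover have "g = ?g" if g: "g \<in> gt_patterns \<nu> (monomial \<nu>)" for g
  proof (intro ext)
    fix k i
    have "g k i = part \<nu> i" if "i < k"
      using sum_mono_inv[of "g k" "{..<k}" "part \<nu>" i] sum_gt_patterns_lessThan[OF g, of k] that g
      by (simp add: sum_take_eq_sum_part gt_patterns_def)
    then show "g k i = ?g k i"
      using gt_patterns_zero[OF g] by simp
  qed
  ultimately show ?thesis by blast
qed

lemma unitriangular_schur: "unitriangular schur"
  unfolding unitriangular_def
proof (intro allI impI conjI)
  fix \<rho> assume \<rho>: "is_partition \<rho>"
  show "symmetric_series (schur \<rho>)" by (rule symmetric_schur[OF \<rho>])
  show "homogeneous (sum_list \<rho>) (schur \<rho>)" by (rule homogeneous_schur)
  show "schur \<rho> (monomial \<rho>) = 1"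
    using \<rho> by (simp add: schur_eq_card_gt_patterns size_monomial gt_patterns_self)
  fix \<tau> assume nz: "schur \<rho> (monomial \<tau>) \<noteq> 0"
  then have s: "sum_list \<tau> = sum_list \<rho>"
    using homogeneous_schur[of \<rho>] by (metis homogeneous_def size_monomial)
  then obtain g where g: "g \<in> gt_patterns \<rho> (monomial \<tau>)"
    using nz \<rho> by (fastforce simp: schur_eq_card_gt_patterns size_monomial)
  have "sum_list (take k \<tau>) \<le> sum_list (take k \<rho>)" for k
    using g unfolding sum_gt_patterns_lessThan[OF g, symmetric] sum_take_eq_sum_part[of k \<rho>]
    by (intro sum_mono) (simp add: gt_patterns_def)
  then show "dominance_le \<tau> \<rho>"
    using s by (simp add: dominance_le_def)
qed

text \<open>An injection of patterns: \<open>?f\<close> shortens the only nonzero row of level 1 by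
  one, which turns the last 0 of the first row of the tableau into a 1.\<close>

lemma schur_monomial_le:
  assumes \<nu>: "is_partition \<nu>" and "b \<le> a"
  shows "schur \<nu> (monomial (Suc (Suc a) # b # xs)) \<le> schur \<nu> (monomial (Suc a # Suc b # xs))"
    (is "schur \<nu> ?M \<le> schur \<nu> ?N")
proof (cases "size ?M = sum_list \<nu>")
  case True
  then have s: "size ?N = sum_list \<nu>" by (simp add: size_monomial)
  let ?f = "\<lambda>g :: nat \<Rightarrow> nat \<Rightarrow> nat. g(1 := (g 1)(0 := Suc a))"
  have g1: "g 1 0 = Suc (Suc a)" and g2: "g 2 0 + g 2 1 = Suc (Suc a) + b"
    if "g \<in> gt_patterns \<nu> ?M" for g
    using sum_gt_patterns_lessThan[OF that, of 1] sum_gt_patterns_lessThan[OF that, of 2]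
    by (auto simp: numeral_2_eq_2)
  have "?f g \<in> gt_patterns \<nu> ?N" if g: "g \<in> gt_patterns \<nu> ?M" for g
  proof -
    have g0: "g 0 i = 0" and mono: "g k i \<le> g (Suc k) i" and inter: "g (Suc k) (Suc i) \<le> g k i"
      and le: "g k i \<le> part \<nu> i"
      and sum: "(\<Sum>i<length \<nu>. g k i) = (\<Sum>c<k. count ?M c)" for i k
      using g by (auto simp: gt_patterns_def)
    \<comment> \<open>Interlacing with level 2 survives: its first row has at least
      \<open>Suc (Suc a)\<close> cells, so its second has at most \<open>b\<close>, and
      \<open>b \<le> a\<close>.\<close>
    have "Suc a \<le> g 2 0" "g 2 1 \<le> Suc a"
      using mono[of 1 0] g1[OF g] g2[OF g] assms(2) by (auto simp: numeral_2_eq_2)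
    moreover have "Suc a \<le> part \<nu> 0"
      using le[of 1 0] g1[OF g] by simp
    moreover have "(\<Sum>i<length \<nu>. ?f g k i) = (\<Sum>c<k. count ?N c)" for k
    proof (cases "k = 1")
      case True
      have "length \<nu> \<noteq> 0"
        using le[of 1 0] g1[OF g] by (auto simp: part_def)
      then have "(\<Sum>i<length \<nu>. ?f g k i) = (\<Sum>i\<in>{0}. ?f g k i)"
        using gt_patterns_zero[OF g, of 1] True by (intro sum.mono_neutral_right) auto
      then show ?thesis using True by (simp add: count_monomial)
    next
      case False
      \<comment> \<open>The two contents differ only in how the first two exponents share their sum,
        which is visible at level 1 alone.\<close>
      have "(\<Sum>c<k. count ?M c) = (\<Sum>c<k. count ?N c)"
      proof (cases k)
        case (Suc k')
        with False obtain k'' where "k = Suc (Suc k'')" by (cases k') auto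
        then show ?thesis
          by (simp only: count_monomial_part flip: sum_take_eq_sum_part) simp
      qed simp
      then show ?thesis using False sum by simp
    qed
    ultimately show ?thesis
      using g0 mono inter le gt_patterns_zero[OF g, of 1] gt_patterns_zero[OF g, of 2]
      unfolding gt_patterns_def
      by (auto simp: numeral_2_eq_2)
  qed
  moreover have "inj_on ?f (gt_patterns \<nu> ?M)"
  proof (rule inj_onI)
    fix g h assume g: "g \<in> gt_patterns \<nu> ?M" and h: "h \<in> gt_patterns \<nu> ?M" and eq: "?f g = ?f h"
    \<comment> \<open>The overwritten entry was \<open>Suc (Suc a)\<close> in both patterns, so no
      information is lost.\<close>
    have "g k i = h k i" for k i
      using g1[OF g] g1[OF h] fun_cong[OF fun_cong[OF eq, of k], of i]
      by (cases "k = 1"; cases "i = 0") auto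
    then show "g = h" by blast
  qed
  ultimately have "card (gt_patterns \<nu> ?M) \<le> card (gt_patterns \<nu> ?N)"
    using finite_gt_patterns[OF \<nu> s] by (intro card_inj_on_le[of ?f]) auto
  then show ?thesis
    using \<nu> True s by (simp add: schur_eq_card_gt_patterns)
next
  case False
  then have "schur \<nu> ?M = 0"
    using homogeneous_schur[of \<nu>] by (auto simp: homogeneous_def)
  then show ?thesis by (simp add: schur_def)
qed

lemma schur_positive_monomial_le:
  assumes "schur_positive f" "symmetric_series f" "homogeneous d f" "b \<le> a"
  shows "f (monomial (Suc (Suc a) # b # xs)) \<le> f (monomial (Suc a # Suc b # xs))"
proof -
  obtain c where c: "is_expansion schur f c"
    using ex_expansion unitriangular_schur assms(2,3) by blast
  then have f: "f M = (\<Sum>\<nu> | c \<nu> \<noteq> 0. c \<nu> * schur \<nu> M)" for M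
    by (simp add: is_expansion_def)
  have "is_partition \<nu>" "0 \<le> c \<nu>" if "c \<nu> \<noteq> 0" for \<nu>
    using c that assms(1) basis_coeff_eq[OF unitriangular_schur c]
    by (auto simp: is_expansion_def schur_positive_def)
  then show ?thesis
    unfolding f using schur_monomial_le assms(4) by (intro sum_mono mult_left_mono) auto
qed

section \<open>Colorings of the squid graph\<close>

lemma count_image_mset_mset_set:
  assumes "finite V"
  shows "count (image_mset \<kappa> (mset_set V)) c = card {v \<in> V. \<kappa> v = c}"
proof -
  have "(\<Sum>v | v \<in> V \<and> c = \<kappa> v. count (mset_set V) v) = card {v \<in> V. c = \<kappa> v}"
    using assms by simp
  then show ?thesis
    using assms by (simp add: count_image_mset' eq_commute[of c])
qed

text \<open>Exchanging two colors is an involution on proper colorings; \<open>restrict\<close>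
  keeps the recolored map extensional.\<close>

lemma symmetric_chromatic_sym:
  assumes "simple_graph V E"
  shows "symmetric_series (chromatic_sym V E)"
  unfolding symmetric_series_def
proof (intro allI)
  fix c M
  let ?t = "Transposition.transpose c (Suc c)"
  let ?f = "\<lambda>\<kappa>. restrict (?t \<circ> \<kappa>) V"
  let ?C = "\<lambda>M. {\<kappa> \<in> proper_colorings V E. image_mset \<kappa> (mset_set V) = M}"
  have E: "v \<in> V \<and> w \<in> V" if "{v, w} \<in> E" for v w
    using assms that by (auto simp: simple_graph_def)
  have V: "finite V" using assms by (simp add: simple_graph_def)
  have tt: "?t a = ?t b \<longleftrightarrow> a = b" for a b
    by (metis transpose_involutory)
  have "?f \<kappa> \<in> proper_colorings V E" if "\<kappa> \<in> proper_colorings V E" for \<kappa>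
    using that E by (auto simp: proper_colorings_def tt)
  moreover have "image_mset (?f \<kappa>) (mset_set V) = image_mset ?t (image_mset \<kappa> (mset_set V))" for \<kappa>
    using V by (auto simp: multiset.map_comp intro!: image_mset_cong)
  ultimately have f: "?f ` ?C M \<subseteq> ?C (image_mset ?t M)" for M
    by auto
  have "?f (?f \<kappa>) = \<kappa>" if "\<kappa> \<in> proper_colorings V E" for \<kappa>
  proof (rule extensionalityI[of _ V])
    show "\<kappa> \<in> extensional V" using that by (simp add: proper_colorings_def PiE_def)
  qed simp_all
  moreover have "image_mset ?t (image_mset ?t M) = M"
    by (simp add: multiset.map_comp)
  ultimately have "bij_betw ?f (?C M) (?C (image_mset ?t M))"
    using f[of M] f[of "image_mset ?t M"] by (intro bij_betw_byWitness[where f' = ?f]) auto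
  then show "chromatic_sym V E (image_mset ?t M) = chromatic_sym V E M"
    by (simp add: chromatic_sym_def bij_betw_same_card)
qed

lemma homogeneous_chromatic_sym: "homogeneous (card V) (chromatic_sym V E)"
  unfolding homogeneous_def chromatic_sym_def
proof (intro allI impI)
  fix M assume "int (card {\<kappa> \<in> proper_colorings V E. image_mset \<kappa> (mset_set V) = M}) \<noteq> 0"
  then have "{\<kappa> \<in> proper_colorings V E. image_mset \<kappa> (mset_set V) = M} \<noteq> {}"
    by (metis card.empty of_nat_0)
  then show "size M = card V" by auto
qed

lemma finite_colorings:
  assumes "finite V"
  shows "finite {\<kappa> \<in> proper_colorings V E. image_mset \<kappa> (mset_set V) = M}"
proof (rule finite_subset)
  show "{\<kappa> \<in> proper_colorings V E. image_mset \<kappa> (mset_set V) = M} \<subseteq> V \<rightarrow>\<^sub>E set_mset M"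
    using assms by (auto simp: proper_colorings_def)
  show "finite (V \<rightarrow>\<^sub>E set_mset M)"
    using assms by (simp add: finite_PiE)
qed

section \<open>Counting colorings with one prescribed color class\<close>

lemma card_subsets_separating:
  assumes "finite W" "a \<in> W" "b \<in> W" "a \<noteq> b"
  shows "card {A. A \<subseteq> W \<and> card A = Suc p \<and> (a \<in> A) \<noteq> (b \<in> A)} = 2 * ((card W - 2) choose p)"
proof -
  let ?P = "{A. A \<subseteq> W - {a, b} \<and> card A = p}"
  have fin: "finite A" if "A \<subseteq> W" for A
    using that assms(1) by (rule finite_subset)
  have "{A. A \<subseteq> W \<and> card A = Suc p \<and> (a \<in> A) \<noteq> (b \<in> A)} = insert a ` ?P \<union> insert b ` ?P"
  proof (intro equalityI subsetI)
    fix A assume A: "A \<in> {A. A \<subseteq> W \<and> card A = Suc p \<and> (a \<in> A) \<noteq> (b \<in> A)}"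
    then consider "a \<in> A" "b \<notin> A" | "b \<in> A" "a \<notin> A" by blast
    then show "A \<in> insert a ` ?P \<union> insert b ` ?P"
    proof cases
      case 1
      then have "A - {a} \<in> ?P" "A = insert a (A - {a})" using A fin by auto
      then show ?thesis by blast
    next
      case 2
      then have "A - {b} \<in> ?P" "A = insert b (A - {b})" using A fin by auto
      then show ?thesis by blast
    qed
  next
    fix A assume "A \<in> insert a ` ?P \<union> insert b ` ?P"
    then obtain B where B: "B \<subseteq> W - {a, b}" "card B = p" "A = insert a B \<or> A = insert b B"
      by blast
    then have "finite B" "a \<notin> B" "b \<notin> B" using fin[of B] by auto
    then have "card A = Suc p" using B by auto
    moreover have "A \<subseteq> W" using B assms(2,3) by blast
    moreover have "(a \<in> A) \<noteq> (b \<in> A)"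
      using B(3) \<open>a \<notin> B\<close> \<open>b \<notin> B\<close> assms(4) by blast
    ultimately show "A \<in> {A. A \<subseteq> W \<and> card A = Suc p \<and> (a \<in> A) \<noteq> (b \<in> A)}" by blast
  qed
  moreover have "inj_on (insert a) ?P" "inj_on (insert b) ?P"
    by (auto intro!: inj_onI)
  moreover have "insert a ` ?P \<inter> insert b ` ?P = {}"
    using assms(4) by auto
  moreover have "finite ?P" using assms(1) by simp
  moreover have "card ?P = (card W - 2) choose p"
  proof -
    have "card (W - {a, b}) = card W - card {a, b}"
      using assms by (intro card_Diff_subset) auto
    then show ?thesis using assms by (simp add: n_subsets numeral_2_eq_2)
  qed
  ultimately show ?thesis
    by (simp add: card_Un_disjoint card_image)
qed

definition independent :: "'a set set \<Rightarrow> 'a set \<Rightarrow> bool" where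
  "independent E S \<longleftrightarrow> (\<forall>e\<in>E. \<not> e \<subseteq> S)"

lemma independent_color_class:
  assumes "simple_graph V E" "\<kappa> \<in> proper_colorings V E"
  shows "independent E {v \<in> V. \<kappa> v = c}"
  unfolding independent_def
proof (intro ballI notI)
  fix e assume e: "e \<in> E" "e \<subseteq> {v \<in> V. \<kappa> v = c}"
  then obtain v w where "e = {v, w}"
    using assms(1) by (metis card_2_iff simple_graph_def)
  moreover have "\<kappa> v \<noteq> \<kappa> w"
    using e(1) assms(2) \<open>e = {v, w}\<close> by (simp add: proper_colorings_def)
  ultimately show False using e(2) by simp
qed

text \<open>Once \<open>S\<close> has color \<open>z\<close>, every edge meeting \<open>S\<close> is
  properly colored because \<open>S\<close> is independent. The edge \<open>{a, b}\<close> is the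
  only constraint left: the class of \<open>x\<close> must contain exactly one of its ends.\<close>

lemma card_colorings_with_class:
  assumes G: "simple_graph V E" and S: "S \<subseteq> V" "independent E S"
    and ab: "{e \<in> E. e \<inter> S = {}} = {{a, b}}" "a \<noteq> b"
    and xyz: "x \<noteq> y" "x \<noteq> z" "y \<noteq> z" and q: "Suc p + q + card S = card V"
  defines "M \<equiv> replicate_mset (Suc p) x + replicate_mset q y + replicate_mset (card S) z"
  shows "card {\<kappa> \<in> proper_colorings V E.
      image_mset \<kappa> (mset_set V) = M \<and> {v \<in> V. \<kappa> v = z} = S}
    = 2 * ((card V - card S - 2) choose p)" (is "card ?C = _")
proof -
  have V: "finite V" and EV: "\<And>e. e \<in> E \<Longrightarrow> e \<subseteq> V"
    using G by (auto simp: simple_graph_def)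
  then have finS: "finite S" using S(1) finite_subset by blast
  have abE: "{a, b} \<in> E" and abS: "a \<notin> S" "b \<notin> S"
    using ab(1) by auto
  have abV: "a \<in> V" "b \<in> V" using EV[OF abE] by auto
  let ?D = "{A. A \<subseteq> V - S \<and> card A = Suc p \<and> (a \<in> A) \<noteq> (b \<in> A)}"
  define f where "f \<kappa> = {v \<in> V. \<kappa> v = x}" for \<kappa> :: "'a \<Rightarrow> nat"
  define h where "h A = (\<lambda>v\<in>V. if v \<in> S then z else if v \<in> A then x else y)" for A
  have "bij_betw f ?C ?D"
  proof (rule bij_betw_byWitness[where f' = h])
    have C: "\<kappa> \<in> V \<rightarrow>\<^sub>E UNIV" "\<kappa> v \<in> {x, y, z}" "\<kappa> v = z \<longleftrightarrow> v \<in> S"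
      if "\<kappa> \<in> ?C" "v \<in> V" for \<kappa> v
    proof -
      show "\<kappa> \<in> V \<rightarrow>\<^sub>E UNIV" using that by (simp add: proper_colorings_def)
      have "\<kappa> v \<in># M" using that V by force
      then show "\<kappa> v \<in> {x, y, z}" by (auto simp: M_def split: if_splits)
      show "\<kappa> v = z \<longleftrightarrow> v \<in> S" using that by blast
    qed
    show "\<forall>\<kappa>\<in>?C. h (f \<kappa>) = \<kappa>"
    proof
      fix \<kappa> assume k: "\<kappa> \<in> ?C"
      then have "\<kappa> \<in> V \<rightarrow>\<^sub>E UNIV" by (simp add: proper_colorings_def)
      then have "\<kappa> \<in> extensional V" by (simp add: PiE_def)
      then show "h (f \<kappa>) = \<kappa>"
        by (intro extensionalityI[of _ V]) (use C[OF k] in \<open>auto simp: h_def f_def\<close>)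
    qed
    show "\<forall>A\<in>?D. f (h A) = A"
      using xyz by (auto simp: f_def h_def split: if_splits)
    show "f ` ?C \<subseteq> ?D"
    proof (rule image_subsetI)
      fix \<kappa> assume k: "\<kappa> \<in> ?C"
      then have "card (f \<kappa>) = count M x"
        using count_image_mset_mset_set[OF V, of \<kappa> x] by (simp add: f_def)
      moreover have "f \<kappa> \<subseteq> V - S" using C(3)[OF k] xyz by (auto simp: f_def)
      moreover have "\<kappa> a \<noteq> \<kappa> b" using k abE by (auto simp: proper_colorings_def)
      then have "(a \<in> f \<kappa>) \<noteq> (b \<in> f \<kappa>)"
        using C(2,3)[OF k abV(1)] C(2,3)[OF k abV(2)] abS abV by (auto simp: f_def)
      ultimately show "f \<kappa> \<in> ?D" using xyz by (auto simp: M_def)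
    qed
    show "h ` ?D \<subseteq> ?C"
    proof (rule image_subsetI)
      fix A assume A: "A \<in> ?D"
      then have finA: "finite A" using V finite_subset by blast
      have "h A v \<noteq> h A w" if vw: "{v, w} \<in> E" for v w
      proof -
        have "v \<in> V" "w \<in> V" using EV[OF vw] by auto
        moreover have "\<not> (v \<in> S \<and> w \<in> S)" using vw S(2) by (auto simp: independent_def)
        moreover have "{v, w} = {a, b}" if "v \<notin> S" "w \<notin> S"
        proof -
          have "{v, w} \<in> {e \<in> E. e \<inter> S = {}}" using that vw by simp
          then show ?thesis unfolding ab(1) by simp
        qed
        then have "(v \<in> A) \<noteq> (w \<in> A)" if "v \<notin> S" "w \<notin> S"
          using that A by (auto simp: doubleton_eq_iff)
        ultimately show ?thesis using xyz by (auto simp: h_def)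
      qed
      then have hP: "h A \<in> proper_colorings V E"
        by (auto simp: proper_colorings_def h_def)
      have z: "{v \<in> V. h A v = z} = S" and x: "{v \<in> V. h A v = x} = A"
        and y: "{v \<in> V. h A v = y} = V - S - A"
        using S(1) A xyz by (auto simp: h_def split: if_splits)
      have o: "card {v \<in> V. h A v = c} = 0" if "c \<noteq> x" "c \<noteq> y" "c \<noteq> z" for c
        using that by (auto simp: h_def)
      have "card (V - S - A) = q"
        using V S(1) A finS finA q by (simp add: card_Diff_subset)
      moreover have "card A = Suc p" using A by simp
      ultimately have "count (image_mset (h A) (mset_set V)) c = count M c" for c
        using xyz x y z o[of c] unfolding count_image_mset_mset_set[OF V] M_def
        by (cases "c = x"; cases "c = y"; cases "c = z") simp_all
      then have "image_mset (h A) (mset_set V) = M" by (rule multiset_eqI)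
      with hP show "h A \<in> ?C" using z by simp
    qed
  qed
  then have "card ?C = card ?D" by (rule bij_betw_same_card)
  also have "\<dots> = 2 * ((card (V - S) - 2) choose p)"
    by (rule card_subsets_separating) (use V abV abS ab(2) in auto)
  finally show ?thesis using finS S(1) by (simp add: card_Diff_subset)
qed

text \<open>Name the edge from \<open>i\<close> to its successor by \<open>i\<close>. The edges
  starting in \<open>I\<close> and those ending in \<open>I\<close> are disjoint families by
  stability, each of size \<open>card I\<close>; the rest are untouched.\<close>

lemma card_untouched_cycle_edges:
  assumes "I \<subseteq> {..<L}" and stable: "\<And>i. i \<in> I \<Longrightarrow> (i + 1) mod L \<notin> I"
  shows "card {i. i < L \<and> i \<notin> I \<and> (i + 1) mod L \<notin> I} + 2 * card I = L"
proof -
  let ?s = "\<lambda>i. (i + 1) mod L"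
  let ?U = "{i. i < L \<and> i \<notin> I \<and> ?s i \<notin> I}"
  define J where "J = {i. i < L \<and> ?s i \<in> I}"
  have inj: "inj_on ?s {..<L}"
  proof (rule inj_onI)
    fix i j assume "i \<in> {..<L}" "j \<in> {..<L}" "?s i = ?s j"
    then show "i = j"
      by (cases "i + 1 = L"; cases "j + 1 = L") auto
  qed
  moreover have "?s ` {..<L} \<subseteq> {..<L}" by auto
  \<comment> \<open>The successor map permutes the cycle, so the preimage \<open>J\<close> of
    \<open>I\<close> has the size of \<open>I\<close>.\<close>
  ultimately have "?s ` {..<L} = {..<L}"
    by (intro endo_inj_surj) simp_all
  have "?s ` J = I"
  proof
    show "?s ` J \<subseteq> I" by (auto simp: J_def)
    show "I \<subseteq> ?s ` J"
    proof
      fix i assume "i \<in> I"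
      then have "i \<in> ?s ` {..<L}"
        using assms(1) \<open>?s ` {..<L} = {..<L}\<close> by blast
      then obtain j where "j < L" "i = ?s j" by blast
      then show "i \<in> ?s ` J"
        using \<open>i \<in> I\<close> by (auto simp: J_def)
    qed
  qed
  moreover have "inj_on ?s J"
    by (rule inj_on_subset[OF inj]) (auto simp: J_def)
  ultimately have "card J = card I"
    by (metis card_image)
  moreover have fin: "finite I" "finite J" "finite ?U"
    using assms(1) finite_subset by (blast, simp_all add: J_def)
  moreover have "I \<inter> J = {}"
    using stable by (auto simp: J_def)
  ultimately have "card (I \<union> J) = 2 * card I"
    by (simp add: card_Un_disjoint)
  moreover have "card (?U \<union> (I \<union> J)) = card ?U + card (I \<union> J)"
    using fin by (intro card_Un_disjoint) (auto simp: J_def)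
  moreover have "?U \<union> (I \<union> J) = {..<L}"
    using assms(1) by (auto simp: J_def)
  then have "card (?U \<union> (I \<union> J)) = L"
    by (simp only: card_lessThan)
  ultimately show ?thesis by linarith
qed

section \<open>Independent sets of the squid graph containing \<open>u\<close>\<close>

lemma card_squid_verts:
  assumes "n \<ge> 1"
  shows "card (squid_verts n) = 3 * n - 1"
proof -
  have "card (squid_verts n) = card (Cyc ` {0..<2 * n - 1}) + card (Leaf ` {1..n})"
    unfolding squid_verts_def by (rule card_Un_disjoint) auto
  then show ?thesis
    using assms by (simp add: card_image inj_on_def)
qed

text \<open>Since \<open>u\<close> lies in \<open>S\<close>, leaves are excluded and all leaf edges
  are touched, so only the odd cycle matters: the number of untouched edges plus
  \<open>2 * card S\<close> is \<open>2 * n - 1\<close>.\<close>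

lemma squid_independent:
  assumes n: "n \<ge> 2" and S: "S \<subseteq> squid_verts n" "Cyc 0 \<in> S" "independent (squid_edges n) S"
  shows "card S \<le> n - 1"
    and "card S = n - 1 \<Longrightarrow> \<exists>a b. a \<noteq> b \<and> {e \<in> squid_edges n. e \<inter> S = {}} = {{a, b}}"
proof -
  define L where "L = 2 * n - 1"
  define I where "I = {i. i < L \<and> Cyc i \<in> S}"
  let ?U = "{i. i < L \<and> i \<notin> I \<and> (i + 1) mod L \<notin> I}"
  have L: "L > 1" using n by (simp add: L_def)
  have "Leaf j \<notin> S" if "j \<in> {1..n}" for j
  proof -
    have "{Cyc 0, Leaf j} \<in> squid_edges n"
      using that by (auto simp: squid_edges_def)
    then show ?thesis using S(2,3) by (auto simp: independent_def)
  qed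
  then have SI: "S = Cyc ` I"
    using S(1) by (auto simp: I_def L_def squid_verts_def)
  then have cS: "card S = card I" by (simp add: card_image inj_on_def)
  have edge: "{Cyc i, Cyc ((i + 1) mod L)} \<in> squid_edges n" if "i < L" for i
    using that by (auto simp: squid_edges_def L_def)
  have "(i + 1) mod L \<notin> I" if "i \<in> I" for i
  proof -
    have "\<not> {Cyc i, Cyc ((i + 1) mod L)} \<subseteq> S"
      using that edge[of i] S(3) unfolding I_def independent_def by blast
    then show ?thesis using that by (simp add: I_def)
  qed
  then have card: "card ?U + 2 * card I = L"
    by (intro card_untouched_cycle_edges) (auto simp: I_def)
  then show "card S \<le> n - 1" using cS by (simp add: L_def)
  have untouched: "{e \<in> squid_edges n. e \<inter> S = {}} = (\<lambda>i. {Cyc i, Cyc ((i + 1) mod L)}) ` ?U"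
  proof (intro equalityI subsetI)
    fix e assume e: "e \<in> {e \<in> squid_edges n. e \<inter> S = {}}"
    then have "Cyc 0 \<notin> e" using S(2) by blast
    then obtain i where i: "i < L" "e = {Cyc i, Cyc ((i + 1) mod L)}"
      using e unfolding squid_edges_def L_def by blast
    then have "i \<in> ?U" using e by (simp add: I_def)
    then show "e \<in> (\<lambda>i. {Cyc i, Cyc ((i + 1) mod L)}) ` ?U" using i(2) by (rule image_eqI[rotated])
  next
    fix e assume "e \<in> (\<lambda>i. {Cyc i, Cyc ((i + 1) mod L)}) ` ?U"
    then obtain i where i: "i \<in> ?U" "e = {Cyc i, Cyc ((i + 1) mod L)}" by blast
    then have "i < L" "(i + 1) mod L < L" using L by auto
    then show "e \<in> {e \<in> squid_edges n. e \<inter> S = {}}"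
      using edge[of i] i by (simp add: I_def)
  qed
  assume "card S = n - 1"
  then have "card ?U = 1" using card cS n by (simp add: L_def)
  then obtain i where i: "?U = {i}" by (auto simp: card_1_singleton_iff)
  then have "i < L" by blast
  then have "i \<noteq> (i + 1) mod L" using L by (cases "i + 1 = L") auto
  then show "\<exists>a b. a \<noteq> b \<and> {e \<in> squid_edges n. e \<inter> S = {}} = {{a, b}}"
    unfolding untouched i by (intro exI[of _ "Cyc i"] exI[of _ "Cyc ((i + 1) mod L)"]) simp
qed

text \<open>The number of these sets is a common factor of both coloring counts, so its exact value
  is never computed; it only has to be positive.\<close>

definition apex_sets :: "nat \<Rightarrow> squid_vertex set set" where
  "apex_sets n = {S. S \<subseteq> squid_verts n \<and> Cyc 0 \<in> S \<and> independent (squid_edges n) S \<and> card S = n - 1}"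

lemma finite_squid_verts: "finite (squid_verts n)"
  by (simp add: squid_verts_def)

lemma finite_apex_sets: "finite (apex_sets n)"
  by (rule finite_subset[of _ "Pow (squid_verts n)"])
    (auto simp: apex_sets_def finite_squid_verts)

lemma apex_sets_nonempty:
  assumes "n \<ge> 2"
  shows "apex_sets n \<noteq> {}"
proof -
  \<comment> \<open>The even positions from 0 to \<open>2 * n - 4\<close>.\<close>
  let ?S = "Cyc ` (\<lambda>k. 2 * k) ` {..<n - 1}"
  have "card ?S = n - 1"
    by (simp add: card_image inj_on_def image_image)
  moreover have "?S \<subseteq> squid_verts n"
    by (auto simp: squid_verts_def)
  moreover have "Cyc 0 \<in> ?S"
    using assms by force
  moreover have "\<not> {Cyc i, Cyc ((i + 1) mod (2 * n - 1))} \<subseteq> ?S" for i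
  proof
    assume *: "{Cyc i, Cyc ((i + 1) mod (2 * n - 1))} \<subseteq> ?S"
    then obtain k where "i = 2 * k" "k < n - 1" by auto
    \<comment> \<open>The successor does not wrap around, because
      \<open>2 * k + 1 < 2 * n - 1\<close>; being odd, it cannot lie in \<open>?S\<close>.\<close>
    then have "Cyc (2 * k + 1) \<in> ?S" using * by simp
    then show False by (auto elim!: image_eqI) presburger
  qed
  then have "\<not> e \<subseteq> ?S" if "e \<in> squid_edges n" for e
    using that unfolding squid_edges_def by blast
  then have "independent (squid_edges n) ?S"
    by (simp add: independent_def)
  ultimately show ?thesis unfolding apex_sets_def by blast
qed

lemma card_squid_colorings_with_apex_color:
  assumes n: "n \<ge> 2" and xyz: "x \<noteq> y" "x \<noteq> z" "y \<noteq> z" and q: "Suc p + q = 2 * n"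
  defines "M \<equiv> replicate_mset (Suc p) x + replicate_mset q y + replicate_mset (n - 1) z"
  shows "card {\<kappa> \<in> proper_colorings (squid_verts n) (squid_edges n).
      image_mset \<kappa> (mset_set (squid_verts n)) = M \<and> \<kappa> (Cyc 0) = z}
    = card (apex_sets n) * (2 * ((2 * n - 2) choose p))" (is "card ?C = _")
proof -
  let ?V = "squid_verts n" and ?E = "squid_edges n"
  let ?B = "\<lambda>S. {\<kappa> \<in> proper_colorings ?V ?E.
      image_mset \<kappa> (mset_set ?V) = M \<and> {v \<in> ?V. \<kappa> v = z} = S}"
  note G = simple_graph_squid[OF n]
  have V: "card ?V = 3 * n - 1" using n by (simp add: card_squid_verts)
  have B: "card (?B S) = 2 * ((2 * n - 2) choose p)" if "S \<in> apex_sets n" for S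
  proof -
    have S: "S \<subseteq> ?V" "Cyc 0 \<in> S" "independent ?E S" "card S = n - 1"
      using that by (auto simp: apex_sets_def)
    obtain a b where ab: "a \<noteq> b" "{e \<in> ?E. e \<inter> S = {}} = {{a, b}}"
      using squid_independent(2)[OF n S] by blast
    have "Suc p + q + card S = card ?V" using n q S(4) V by simp
    from card_colorings_with_class[OF G S(1,3) ab(2,1) xyz this]
    have "card (?B S) = 2 * ((card ?V - card S - 2) choose p)"
      unfolding M_def S(4) .
    moreover have "card ?V - card S - 2 = 2 * n - 2" using n V S(4) by simp
    ultimately show ?thesis by simp
  qed
  \<comment> \<open>The colorings are sorted by the class of \<open>u\<close>, which is an apex set
    because \<open>z\<close> occurs \<open>n - 1\<close> times.\<close>
  have "?C = (\<Union>S\<in>apex_sets n. ?B S)"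
  proof (intro equalityI subsetI)
    fix \<kappa> assume k: "\<kappa> \<in> ?C"
    have "card {v \<in> ?V. \<kappa> v = z} = count M z"
      using k count_image_mset_mset_set[OF finite_squid_verts, of \<kappa> n z] by simp
    then have "card {v \<in> ?V. \<kappa> v = z} = n - 1"
      using xyz by (simp add: M_def)
    moreover have "Cyc 0 \<in> ?V" using n by (auto simp: squid_verts_def)
    ultimately have "{v \<in> ?V. \<kappa> v = z} \<in> apex_sets n"
      using k independent_color_class[OF G, of \<kappa> z] by (auto simp: apex_sets_def)
    then show "\<kappa> \<in> (\<Union>S\<in>apex_sets n. ?B S)" using k by blast
  qed (auto simp: apex_sets_def)
  moreover have "finite (?B S)" if "S \<in> apex_sets n" for S
    by (rule finite_subset[OF _ finite_colorings[OF finite_squid_verts, of n ?E M]]) blast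
  ultimately have "card ?C = (\<Sum>S\<in>apex_sets n. card (?B S))"
    using finite_apex_sets by (simp only:) (rule card_UN_disjoint; auto)
  then show ?thesis using B by simp
qed


text \<open>Determines which colors \<open>u\<close> can take: those used at least once but at most
  \<open>n - 1\<close> times.\<close>

lemma apex_color_count_le:
  assumes n: "n \<ge> 2" and \<kappa>: "\<kappa> \<in> proper_colorings (squid_verts n) (squid_edges n)"
  defines "M \<equiv> image_mset \<kappa> (mset_set (squid_verts n))"
  shows "\<kappa> (Cyc 0) \<in># M" and "count M (\<kappa> (Cyc 0)) \<le> n - 1"
proof -
  let ?S = "{v \<in> squid_verts n. \<kappa> v = \<kappa> (Cyc 0)}"
  have u: "Cyc 0 \<in> squid_verts n" using n by (auto simp: squid_verts_def)
  then show "\<kappa> (Cyc 0) \<in># M" by (simp add: M_def finite_squid_verts)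
  have "card ?S \<le> n - 1"
    using u independent_color_class[OF simple_graph_squid[OF n] \<kappa>]
    by (intro squid_independent(1)[OF n]) auto
  then show "count M (\<kappa> (Cyc 0)) \<le> n - 1"
    by (simp add: M_def count_image_mset_mset_set finite_squid_verts)
qed

lemma chromatic_sym_squid_less:
  assumes n: "n \<ge> 3"
  shows "chromatic_sym (squid_verts n) (squid_edges n) (monomial [n, n, n - 1])
    < chromatic_sym (squid_verts n) (squid_edges n) (monomial [n + 1, n - 1, n - 1])"
proof -
  have n2: "n \<ge> 2" using n by simp
  obtain k where k: "n = Suc (Suc k)" "k \<ge> 1"
    using n by (metis Suc_le_D Suc_le_mono numeral_3_eq_3 One_nat_def)
  let ?C = "\<lambda>M z. {\<kappa> \<in> proper_colorings (squid_verts n) (squid_edges n).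
      image_mset \<kappa> (mset_set (squid_verts n)) = M \<and> \<kappa> (Cyc 0) = z}"
  let ?X = "\<lambda>M. {\<kappa> \<in> proper_colorings (squid_verts n) (squid_edges n).
      image_mset \<kappa> (mset_set (squid_verts n)) = M}"
  let ?M = "monomial [n, n, n - 1]" and ?N = "monomial [n + 1, n - 1, n - 1]"
  let ?c = "card (apex_sets n)"
  have mon: "monomial [a, b, c] = replicate_mset a 0 + replicate_mset b 1 + replicate_mset c 2"
    for a b c
    by (rule multiset_eqI) (auto simp: count_monomial nth_Cons' less_Suc_eq)
  have apex: "\<kappa> (Cyc 0) < 3 \<and> count M (\<kappa> (Cyc 0)) \<le> n - 1"
    if "\<kappa> \<in> ?X M" "M = monomial [a, b, c]" for \<kappa> M a b c
  proof -
    have im: "image_mset \<kappa> (mset_set (squid_verts n)) = M" using that(1) by blast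
    have "\<kappa> (Cyc 0) \<in># M" "count M (\<kappa> (Cyc 0)) \<le> n - 1"
      using apex_color_count_le[OF n2, of \<kappa>] that(1) unfolding im by blast+
    moreover have "z < 3" if "z \<in># M" for z
      using that unfolding \<open>M = monomial [a, b, c]\<close> mon by (auto split: if_splits)
    ultimately show ?thesis by blast
  qed
  \<comment> \<open>Colors 0 and 1 are used \<open>n\<close> times, too often for
    \<open>u\<close>.\<close>
  have "?X ?M = ?C ?M 2"
  proof (intro equalityI subsetI)
    fix \<kappa> assume "\<kappa> \<in> ?X ?M"
    then show "\<kappa> \<in> ?C ?M 2"
      using apex[of \<kappa> ?M n n "n - 1"] n
      by (auto simp: count_monomial numeral_3_eq_3 less_Suc_eq numeral_2_eq_2)
  qed blast
  then have M: "card (?X ?M) = ?c * (2 * ((2 * n - 2) choose (n - 1)))"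
    using card_squid_colorings_with_apex_color[OF n2, of 0 1 2 "n - 1" n] n by (simp add: mon)
  \<comment> \<open>Here only color 0 is used too often; colors 1 and 2 are both available for
    \<open>u\<close>, which produces the extra factor 2.\<close>
  have "?X ?N = ?C ?N 1 \<union> ?C ?N 2"
  proof (intro equalityI subsetI)
    fix \<kappa> assume "\<kappa> \<in> ?X ?N"
    then show "\<kappa> \<in> ?C ?N 1 \<union> ?C ?N 2"
      using apex[of \<kappa> ?N "n + 1" "n - 1" "n - 1"] n
      by (auto simp: count_monomial numeral_3_eq_3 less_Suc_eq numeral_2_eq_2)
  qed blast
  moreover have "finite (?C ?N z)" for z
    by (rule finite_subset[OF _ finite_colorings[OF finite_squid_verts, of n "squid_edges n" ?N]]) blast
  ultimately have "card (?X ?N) = card (?C ?N 1) + card (?C ?N 2)"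
    by (simp only:) (rule card_Un_disjoint; auto)
  moreover have "card (?C ?N 2) = ?c * (2 * ((2 * n - 2) choose n))"
    using card_squid_colorings_with_apex_color[OF n2, of 0 1 2 n "n - 1"] n by (simp add: mon)
  moreover have "card (?C ?N 1) = ?c * (2 * ((2 * n - 2) choose n))"
    using card_squid_colorings_with_apex_color[OF n2, of 0 2 1 n "n - 1"] n
    by (simp add: mon ac_simps)
  ultimately have N: "card (?X ?N) = 2 * ?c * (2 * ((2 * n - 2) choose n))"
    by simp
  \<comment> \<open>The ratio of the two neighbouring binomial coefficients is
    \<open>(n - 1) / n\<close>. Doubling it exceeds 1 exactly when \<open>n > 2\<close>.\<close>
  have "n * ((2 * n - 2) choose n) = (n - 1) * ((2 * n - 2) choose (n - 1))"
  proof -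
    have e: "2 * n - 2 = Suc (Suc k + k)" "n - 1 = Suc k" using k by simp_all
    show ?thesis unfolding e unfolding k(1) by (rule Suc_times_binomial_add)
  qed
  moreover have "0 < (2 * n - 2) choose (n - 1)"
    using n by simp
  ultimately have "n * ((2 * n - 2) choose (n - 1)) < n * (2 * ((2 * n - 2) choose n))"
  proof -
    assume eq: "n * ((2 * n - 2) choose n) = (n - 1) * ((2 * n - 2) choose (n - 1))"
      and pos: "0 < (2 * n - 2) choose (n - 1)"
    have "n < 2 * (n - 1)" using n by simp
    then have "n * ((2 * n - 2) choose (n - 1)) < 2 * (n - 1) * ((2 * n - 2) choose (n - 1))"
      using pos by (rule mult_strict_right_mono)
    also have "\<dots> = n * (2 * ((2 * n - 2) choose n))"
      unfolding mult.assoc eq[symmetric] by (rule mult.left_commute)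
    finally show ?thesis .
  qed
  then have "(2 * n - 2) choose (n - 1) < 2 * ((2 * n - 2) choose n)"
    by simp
  moreover have "0 < ?c"
    using apex_sets_nonempty[OF n2] finite_apex_sets by (simp add: card_gt_0_iff)
  ultimately have "card (?X ?M) < card (?X ?N)"
    unfolding M N by (simp add: algebra_simps)
  then show ?thesis by (simp add: chromatic_sym_def)
qed

theorem theorem4p1:
  fixes n :: nat
  assumes "n \<ge> 3"
  shows "\<not> strongly_nice (squid_verts n) (squid_edges n) \<and>
         \<not> schur_positive (chromatic_sym (squid_verts n) (squid_edges n))"
proof
  let ?X = "chromatic_sym (squid_verts n) (squid_edges n)"
  have sym: "symmetric_series ?X"
    using simple_graph_squid assms by (intro symmetric_chromatic_sym) simp
  note hom = homogeneous_chromatic_sym[of "squid_verts n" "squid_edges n"]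
  note less = chromatic_sym_squid_less[OF assms]
  have "is_partition [n, n, n - 1]" "is_partition [n + 1, n - 1, n - 1]"
    using assms by (auto simp: is_partition_def)
  moreover have "dominance_le [n, n, n - 1] [n + 1, n - 1, n - 1]"
    using assms by (auto simp: dominance_le_def take_Cons split: nat.split)
  ultimately show "\<not> strongly_nice (squid_verts n) (squid_edges n)"
    using strongly_nice_monomial[OF _ sym hom] less by (meson linorder_not_le)
  \<comment> \<open>With \<open>n = Suc a\<close> the two exponent lists have the form compared by
    \<open>schur_positive_monomial_le\<close>, with \<open>b = a\<close> and tail
    \<open>[a]\<close>.\<close>
  obtain a where "n = Suc a"
    using assms by (cases n) auto
  then show "\<not> schur_positive ?X"
    using schur_positive_monomial_le[OF _ sym hom, of a a "[a]"] less by auto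
qed

end
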